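(* Suppose that $\rho\in\mathcal M^\flat$ and let $\mathfrak z_c=\frac1b$. (1) If $\mathfrak z(\rho)\le\mathfrak z_c$, then $\mathbb P_\rho(|\mathcal A^{(v)}|=\infty)=0$ for all $v\in(0,\infty)$. (2) If $\mathfrak z(\rho)>\mathfrak z_c$, then $\mathbb P_\rho(|\mathcal A^{(v)}|=\infty)>0$ for all $v\in(1-x_\star,\infty)$.
   Context: Let $b>1$ be an integer and let $\mathbb T_b$ be the $b$-nary rooted tree: the sites of layer $k\ge0$ are the sequences $\sigma=(\sigma_1,\dots,\sigma_k)\in\{1,\dots,b\}^k$; write $|\sigma|=k$; the root $\varnothing$ is the empty sequence; for $|\sigma|=k\ge1$ the mother of $\sigma$ is $m(\sigma)=(\sigma_1,\dots,\sigma_{k-1})$. For a Borel probability measure $\rho$ on $[0,1]$ let $\boldsymbol X=(X_\sigma)_{\sigma\in\mathbb T_b}$ be i.i.d. with law $\rho$, with joint law $\mathbb P_\rho=\rho^{\mathbb T_b}$. Avalanche process. For $v\in[0,\infty)$ put $X^{(v)}_\varnothing(0)=X_\varnothing+v$ and $X^{(v)}_\sigma(0)=X_\sigma$ for $\sigma\ne\varnothing$, and for $t=0,1,2,\dots$ $$X^{(v)}_\sigma(t+1)=\begin{cases} X^{(v)}_\sigma(t)+\frac1bX^{(v)}_{m(\sigma)}(t),&\text{if }|\sigma|=t+1\text{ and }X^{(v)}_{m(\sigma)}(t)\ge1,\\ 0,&\text{if }|\sigma|=t\text{ and }X^{(v)}_\sigma(t)\ge1,\\ X^{(v)}_\sigma(t),&\text{otherwise.}\end{cases}$$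 The avalanche set is $\mathcal A^{(v)}=\bigcup_{t\ge0}\{\sigma\colon X^{(v)}_\sigma(t)=0,\ X^{(v)}_\sigma(s)\ne0\text{ for some }s<t\}$, and $|\mathcal A^{(v)}|$ is its (possibly infinite) cardinality. $\mathcal M^\flat$ is the set of Borel probability measures $\rho$ on $[0,1]$ that are absolutely continuous with respect to Lebesgue measure with a density $\phi_\rho$ satisfying $\|\phi_\rho\|_\infty<\infty$ (essential supremum norm), and that satisfy $\rho([1-\frac1b,1])>0$. Put $x_\star=\sup\{y\in[0,1]\colon\rho([y,1])>0\}$. The functional $\mathfrak z$. Let $X_1,X_2,\dots$ be i.i.d. with law $\rho$ under $\mathbb P$. For $\theta\ge0$ let $Q_0^{(\theta)}=\theta$ and $Q_n^{(\theta)}=X_n+\frac{X_{n-1}}b+\dots+\frac{X_1}{b^{n-1}}+\frac{\theta}{b^n}$ for $n\ge1$, and $Z_n(\theta)=\mathbb P(Q_k^{(\theta)}\ge1,\ k=0,\dots,n)$. Then $\mathfrak z(\rho)=\lim_{n\to\infty}Z_n(\theta)^{1/n}$ for $\theta\ge1$; this limit exists and does not depend on $\theta\ge1$. *)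

theory Defs
  imports "HOL-Probability.Probability"
begin

text \<open>Sites are lists whose last entry is the most recent label, so that the mother of a
  site is its \<^const>\<open>butlast\<close>.\<close>

definition tree :: "nat \<Rightarrow> nat list set" where
  "tree b = {\<sigma>. set \<sigma> \<subseteq> {1..b}}"

definition mother :: "nat list \<Rightarrow> nat list" where
  "mother \<sigma> = butlast \<sigma>"

definition joint_law :: "nat \<Rightarrow> real measure \<Rightarrow> (nat list \<Rightarrow> real) measure" where
  "joint_law b \<rho> = PiM (tree b) (\<lambda>_. \<rho>)"

primrec process :: "nat \<Rightarrow> real \<Rightarrow> (nat list \<Rightarrow> real) \<Rightarrow> nat \<Rightarrow> nat list \<Rightarrow> real" where
  "process b v X 0 = (\<lambda>\<sigma>. if \<sigma> = [] then X \<sigma> + v else X \<sigma>)"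
| "process b v X (Suc t) = (\<lambda>\<sigma>.
     if length \<sigma> = Suc t \<and> process b v X t (mother \<sigma>) \<ge> 1
       then process b v X t \<sigma> + 1 / real b * process b v X t (mother \<sigma>)
     else if length \<sigma> = t \<and> process b v X t \<sigma> \<ge> 1 then 0
     else process b v X t \<sigma>)"

definition avalanche :: "nat \<Rightarrow> real \<Rightarrow> (nat list \<Rightarrow> real) \<Rightarrow> nat list set" where
  "avalanche b v X =
     (\<Union>t. {\<sigma> \<in> tree b. process b v X t \<sigma> = 0 \<and> (\<exists>s<t. process b v X s \<sigma> \<noteq> 0)})"

text \<open>A Borel probability measure on \<open>[0,1]\<close> is encoded as a Borel probability measure on the
  reals giving full mass to \<open>[0,1]\<close>. Densities take values in \<^typ>\<open>ennreal\<close>, so their essential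
  supremum is the essential supremum norm.\<close>

definition M_flat :: "nat \<Rightarrow> real measure set" where
  "M_flat b = {\<rho>. prob_space \<rho> \<and> sets \<rho> = sets borel \<and> measure \<rho> {0..1} = 1 \<and>
     (\<exists>\<phi> :: real \<Rightarrow> ennreal. \<phi> \<in> borel_measurable lborel \<and> \<rho> = density lborel \<phi> \<and>
        esssup lborel \<phi> < \<infinity>) \<and>
     measure \<rho> {1 - 1 / real b..1} > 0}"

definition x_star :: "real measure \<Rightarrow> real" where
  "x_star \<rho> = Sup {y \<in> {0..1}. measure \<rho> {y..1} > 0}"

definition Q :: "nat \<Rightarrow> real \<Rightarrow> (nat \<Rightarrow> real) \<Rightarrow> nat \<Rightarrow> real" where
  "Q b \<theta> X n = (\<Sum>j=1..n. X j / real b ^ (n - j)) + \<theta> / real b ^ n"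

definition Z :: "nat \<Rightarrow> real measure \<Rightarrow> nat \<Rightarrow> real \<Rightarrow> real" where
  "Z b \<rho> n \<theta> = \<P>(X in PiM {1..} (\<lambda>_. \<rho>). \<forall>k\<le>n. Q b \<theta> X k \<ge> 1)"

text \<open>The common limit for all \<open>\<theta> \<ge> 1\<close>; a description, because existence and independence
  of \<open>\<theta>\<close> are theorems (for \<open>\<rho>\<close> in \<^const>\<open>M_flat\<close>).\<close>

definition z_fun :: "nat \<Rightarrow> real measure \<Rightarrow> real" where
  "z_fun b \<rho> = (THE z. \<forall>\<theta>\<ge>1. (\<lambda>n. root n (Z b \<rho> n \<theta>)) \<longlonglongrightarrow> z)"

text \<open>The events whose probabilities are taken are measurable: \<^const>\<open>measure\<close> would
  silently be \<open>0\<close> on a non-measurable set.\<close>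

lemma measurable_process:
  assumes "sets \<rho> = sets borel" "\<sigma> \<in> tree b"
  shows "(\<lambda>X. process b v X t \<sigma>) \<in> borel_measurable (joint_law b \<rho>)"
  using assms(2)
proof (induction t arbitrary: \<sigma>)
  case 0
  have "(\<lambda>X. X \<sigma>) \<in> measurable (joint_law b \<rho>) \<rho>"
    unfolding joint_law_def using 0 by (rule measurable_component_singleton)
  then have [measurable]: "(\<lambda>X. X \<sigma>) \<in> borel_measurable (joint_law b \<rho>)"
    using measurable_cong_sets[OF refl assms(1)] by blast
  show ?case unfolding process.simps by measurable
next
  case (Suc t)
  have "mother \<sigma> \<in> tree b"
    using Suc.prems by (auto simp: tree_def mother_def dest: in_set_butlastD)
  from Suc.IH[OF this] Suc.IH[OF Suc.prems]
  have [measurable]: "(\<lambda>X. process b v X t (mother \<sigma>)) \<in> borel_measurable (joint_law b \<rho>)"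
    "(\<lambda>X. process b v X t \<sigma>) \<in> borel_measurable (joint_law b \<rho>)" .
  show ?case unfolding process.simps by measurable
qed

lemma sets_infinite_avalanche:
  assumes "sets \<rho> = sets borel"
  shows "{X \<in> space (joint_law b \<rho>). infinite (avalanche b v X)} \<in> sets (joint_law b \<rho>)"
proof -
  have inf: "infinite (avalanche b v X) \<longleftrightarrow>
      (\<forall>xs. \<exists>\<sigma>\<in>tree b - set xs. \<sigma> \<in> avalanche b v X)" for X
  proof -
    have sub: "avalanche b v X \<subseteq> tree b" by (auto simp: avalanche_def)
    have "infinite (avalanche b v X) \<longleftrightarrow> (\<forall>xs. \<not> avalanche b v X \<subseteq> set xs)"
      by (metis List.finite_set finite_list finite_subset order_refl)
    then show ?thesis using sub by (simp add: subset_iff Bex_def) blast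
  qed
  have pred: "Measurable.pred (joint_law b \<rho>) (\<lambda>X. \<sigma> \<in> avalanche b v X)"
    if "\<sigma> \<in> tree b" for \<sigma>
  proof -
    have [measurable]: "(\<lambda>X. process b v X t \<sigma>) \<in> borel_measurable (joint_law b \<rho>)" for t
      using measurable_process[OF assms that] .
    have "\<sigma> \<in> avalanche b v X \<longleftrightarrow>
        (\<exists>t. process b v X t \<sigma> = 0 \<and> (\<exists>s<t. process b v X s \<sigma> \<noteq> 0))" for X
      using that by (auto simp: avalanche_def)
    then show ?thesis by simp
  qed
  have "Measurable.pred (joint_law b \<rho>) (\<lambda>X. infinite (avalanche b v X))"
    unfolding inf
    by (intro pred_intros_countable(1) pred_intros_countable_bounded(4)) (auto intro: pred)
  then show ?thesis by (simp add: pred_def)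
qed

lemma sets_Q_event:
  assumes "sets \<rho> = sets borel"
  shows "{X \<in> space (PiM {1..} (\<lambda>_. \<rho>)). \<forall>k\<le>n. Q b \<theta> X k \<ge> 1} \<in> sets (PiM {1..} (\<lambda>_. \<rho>))"
proof -
  have X: "(\<lambda>X. X j) \<in> borel_measurable (PiM {1::nat..} (\<lambda>_. \<rho>))" if "j \<in> {1..k}" for j k
  proof -
    have "(\<lambda>X. X j) \<in> measurable (PiM {1::nat..} (\<lambda>_. \<rho>)) \<rho>"
      using that by (intro measurable_component_singleton) auto
    then show ?thesis using measurable_cong_sets[OF refl assms] by blast
  qed
  have [measurable]: "(\<lambda>X. Q b \<theta> X k) \<in> borel_measurable (PiM {1..} (\<lambda>_. \<rho>))" for k
    unfolding Q_def
    by (intro borel_measurable_add borel_measurable_sum borel_measurable_divide X) auto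
  show ?thesis by measurable
qed

end

theory Submission
  imports Defs
begin

text \<open>A single line of descent of the avalanche is the autoregressive process \<open>q \<mapsto> X + q/b\<close>
  killed below \<open>1\<close>, so its survival probabilities are iterates \<open>Z\<^sub>n = L\<^sup>n 1\<^bsub>[1,\<infinity>)\<^esub>\<close> of a
  linear operator \<open>L\<close> (\<open>line\<close> below). The \<open>b\<close> subtrees under a toppled site are independent copies,
  so the probability \<open>S\<^sub>n(q)\<close> that an avalanche with root load \<open>q\<close> reaches depth \<open>n\<close> is an iterate
  of a nonlinear operator (\<open>branch\<close>): with \<open>a\<close> the expectation of \<open>f(X + q/b)\<close>, the first sends
  \<open>f(q)\<close> to \<open>a\<close> and the second sends it to \<open>1 - (1 - a)\<^sup>b\<close>, both for \<open>q \<ge> 1\<close> only. The theorem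
  compares these two operators on monotone functions with values in \<open>[0,1]\<close>.

  Growth rate. As \<open>Z\<^sub>n(\<theta>)\<close> increases in \<open>\<theta>\<close>, restarting from load \<open>1\<close> shows that \<open>Z\<^sub>n(1)\<close> is
  supermultiplicative; hence \<open>Z\<^sub>n(1) \<le> z\<^sup>n\<close> with \<open>z\<close> the supremum of the roots, and \<open>z\<close> is their
  limit. Loads drift to at most the fixed point \<open>q\<^sub>\<star> = x\<^sub>\<star> b / (b - 1)\<close> of \<open>q \<mapsto> x\<^sub>\<star> + q/b\<close>.
  Below \<open>q\<^sub>\<star>\<close> every load is exceeded from load \<open>1\<close> with positive probability after finitely
  many steps (lemma \<open>reach\<close>), so \<open>Z\<^sub>n(\<theta>) \<le> C z\<^sup>n\<close> there. From loads above \<open>q\<^sub>\<star>\<close> one either drops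
  a fixed amount below \<open>q\<^sub>\<star>\<close> or draws a value near \<open>x\<^sub>\<star>\<close>, and the latter has arbitrarily small
  probability because the law has no atoms (lemma \<open>decomposition_bound\<close>); this carries the bound
  to all \<open>\<theta>\<close> and identifies \<open>z\<close> with the functional of the theorem.

  Extinction, critical case included. If \<open>S\<^sub>n(1)\<close> stayed above a positive constant, then so would
  \<open>a\<close>, and \<open>1 - (1 - a)\<^sup>b \<le> (b - a) a\<close> would replace the factor \<open>b\<close> of the linear bound by some
  \<open>b - c\<close> with \<open>c > 0\<close>; then \<open>S\<^sub>n(1) \<le> ((b - c) z)\<^sup>n\<close>, which tends to \<open>0\<close> as soon as \<open>b z \<le> 1\<close>.
  The lemmas \<open>reach\<close> and \<open>decomposition_bound\<close> transport the limit \<open>0\<close> from load \<open>1\<close> to all loads.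

  Survival. If \<open>b z > 1\<close>, some \<open>m\<close> has \<open>b\<^sup>m Z\<^sub>m(1) > 1\<close>. On functions bounded by a small \<open>p\<close> the
  branching operator is nearly \<open>b\<close> times the linear one, so \<open>m\<close> branching steps do not decrease
  \<open>p 1\<^bsub>[1,\<infinity>)\<^esub>\<close>, and by monotonicity \<open>S\<^sub>n \<ge> p 1\<^bsub>[1,\<infinity>)\<^esub>\<close> for all \<open>n\<close>.\<close>

section \<open>Toppled sites\<close>

text \<open>The load of a site when all its ancestors topple and the root carries \<open>q\<close>. The recursion
  peels off the first label, so that it passes to the subtree of a child of the root. The value of
  the root itself is contained in \<open>q\<close>.\<close>

primrec total :: "nat \<Rightarrow> real \<Rightarrow> (nat list \<Rightarrow> real) \<Rightarrow> nat list \<Rightarrow> real" where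
  "total b q X [] = q"
| "total b q X (i # \<tau>) = total b (X [i] + q / real b) (\<lambda>\<sigma>. X (i # \<sigma>)) \<tau>"

primrec toppled :: "nat \<Rightarrow> real \<Rightarrow> (nat list \<Rightarrow> real) \<Rightarrow> nat list \<Rightarrow> bool" where
  "toppled b q X [] \<longleftrightarrow> 1 \<le> q"
| "toppled b q X (i # \<tau>) \<longleftrightarrow> 1 \<le> q \<and> toppled b (X [i] + q / real b) (\<lambda>\<sigma>. X (i # \<sigma>)) \<tau>"

definition grows :: "nat \<Rightarrow> nat \<Rightarrow> real \<Rightarrow> (nat list \<Rightarrow> real) \<Rightarrow> bool" where
  "grows b n q X \<longleftrightarrow> (\<exists>\<sigma>\<in>tree b. length \<sigma> = n \<and> toppled b q X \<sigma>)"

lemma tree_simps [simp]: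
  "[] \<in> tree b" "i # \<tau> \<in> tree b \<longleftrightarrow> i \<in> {1..b} \<and> \<tau> \<in> tree b"
  "\<sigma> @ [i] \<in> tree b \<longleftrightarrow> i \<in> {1..b} \<and> \<sigma> \<in> tree b"
  by (auto simp: tree_def)

lemma total_snoc: "total b q X (\<sigma> @ [i]) = X (\<sigma> @ [i]) + total b q X \<sigma> / real b"
  by (induction \<sigma> arbitrary: q X) simp_all

lemma toppled_snoc: "toppled b q X (\<sigma> @ [i]) \<longleftrightarrow> toppled b q X \<sigma> \<and> 1 \<le> total b q X (\<sigma> @ [i])"
  by (induction \<sigma> arbitrary: q X) auto

lemma toppled_imp_total: "toppled b q X \<sigma> \<Longrightarrow> 1 \<le> total b q X \<sigma>"
  by (induction \<sigma> arbitrary: q X) auto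

lemma toppled_take: "toppled b q X \<sigma> \<Longrightarrow> toppled b q X (take n \<sigma>)"
  by (induction \<sigma> arbitrary: q X n) (auto simp: take_Cons split: nat.split)

text \<open>Independence of the root value, needed to replace \<open>X []\<close> by a deterministic load.\<close>

lemma total_cong:
  "(\<And>\<tau>. \<tau> \<noteq> [] \<Longrightarrow> \<tau> \<in> tree b \<Longrightarrow> X \<tau> = Y \<tau>) \<Longrightarrow> \<sigma> \<in> tree b \<Longrightarrow>
   total b q X \<sigma> = total b q Y \<sigma>"
  by (induction \<sigma> rule: rev_induct) (auto simp: total_snoc)

lemma toppled_cong:
  "(\<And>\<tau>. \<tau> \<noteq> [] \<Longrightarrow> \<tau> \<in> tree b \<Longrightarrow> X \<tau> = Y \<tau>) \<Longrightarrow> \<sigma> \<in> tree b \<Longrightarrow>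
   toppled b q X \<sigma> = toppled b q Y \<sigma>"
  by (induction \<sigma> rule: rev_induct) (auto simp: toppled_snoc total_snoc cong: total_cong)

lemma grows_cong:
  "(\<And>\<tau>. \<tau> \<noteq> [] \<Longrightarrow> \<tau> \<in> tree b \<Longrightarrow> X \<tau> = Y \<tau>) \<Longrightarrow> grows b n q X = grows b n q Y"
  unfolding grows_def using toppled_cong[of b X Y] by blast

lemma grows_0: "grows b 0 q X \<longleftrightarrow> 1 \<le> q"
  by (auto simp: grows_def)

lemma grows_Suc:
  "grows b (Suc n) q X \<longleftrightarrow> 1 \<le> q \<and> (\<exists>i\<in>{1..b}. grows b n (X [i] + q / real b) (\<lambda>\<sigma>. X (i # \<sigma>)))"
proof
  assume "grows b (Suc n) q X"
  then obtain i \<tau> where "i \<in> {1..b}" "\<tau> \<in> tree b" "length \<tau> = n" "toppled b q X (i # \<tau>)"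
    by (auto simp: grows_def length_Suc_conv)
  then show "1 \<le> q \<and> (\<exists>i\<in>{1..b}. grows b n (X [i] + q / real b) (\<lambda>\<sigma>. X (i # \<sigma>)))"
    by (auto simp: grows_def)
next
  assume "1 \<le> q \<and> (\<exists>i\<in>{1..b}. grows b n (X [i] + q / real b) (\<lambda>\<sigma>. X (i # \<sigma>)))"
  then obtain i \<tau> where "1 \<le> q" "i \<in> {1..b}" "\<tau> \<in> tree b" "length \<tau> = n"
    "toppled b (X [i] + q / real b) (\<lambda>\<sigma>. X (i # \<sigma>)) \<tau>" by (auto simp: grows_def)
  then show "grows b (Suc n) q X" by (auto simp: grows_def intro!: bexI[of _ "i # \<tau>"])
qed

lemma grows_antimono:
  assumes "grows b n q X" "m \<le> n" shows "grows b m q X"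
proof -
  obtain \<sigma> where "\<sigma> \<in> tree b" "length \<sigma> = n" "toppled b q X \<sigma>"
    using assms by (auto simp: grows_def)
  then have "take m \<sigma> \<in> tree b" "length (take m \<sigma>) = m" "toppled b q X (take m \<sigma>)"
    using assms(2) set_take_subset[of m \<sigma>] by (auto simp: tree_def toppled_take)
  then show ?thesis unfolding grows_def by blast
qed

text \<open>The toppled sites form a finitely branching tree, so they are infinite in number iff they
  occupy every level.\<close>

lemma infinite_toppled_iff:
  "infinite {\<sigma> \<in> tree b. toppled b q X \<sigma>} \<longleftrightarrow> (\<forall>n. grows b n q X)"
proof
  assume inf: "infinite {\<sigma> \<in> tree b. toppled b q X \<sigma>}"
  show "\<forall>n. grows b n q X"
  proof (rule ccontr)
    assume "\<not> ?thesis"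
    then obtain n where n: "\<not> grows b n q X" by blast
    have "{\<sigma> \<in> tree b. toppled b q X \<sigma>} \<subseteq> {\<sigma>. set \<sigma> \<subseteq> {1..b} \<and> length \<sigma> \<le> n}"
    proof clarify
      fix \<sigma> assume "\<sigma> \<in> tree b" "toppled b q X \<sigma>"
      moreover from this have "grows b (length \<sigma>) q X" by (auto simp: grows_def)
      then have "\<not> n \<le> length \<sigma>" using n grows_antimono by blast
      ultimately show "set \<sigma> \<subseteq> {1..b} \<and> length \<sigma> \<le> n" by (simp add: tree_def)
    qed
    with inf show False using finite_lists_length_le[of "{1..b}" n] finite_subset by blast
  qed
next
  assume all: "\<forall>n. grows b n q X"
  show "infinite {\<sigma> \<in> tree b. toppled b q X \<sigma>}"
  proof
    assume "finite {\<sigma> \<in> tree b. toppled b q X \<sigma>}"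
    then have "finite (length ` {\<sigma> \<in> tree b. toppled b q X \<sigma>})" by simp
    moreover have "length ` {\<sigma> \<in> tree b. toppled b q X \<sigma>} = UNIV"
    proof (intro equalityI subsetI UNIV_I)
      fix n
      obtain \<sigma> where "\<sigma> \<in> tree b" "length \<sigma> = n" "toppled b q X \<sigma>"
        using all by (auto simp: grows_def)
      then show "n \<in> length ` {\<sigma> \<in> tree b. toppled b q X \<sigma>}" by blast
    qed
    ultimately show False by simp
  qed
qed

text \<open>Values in \<open>[0,1)\<close> exclude two artefacts of the dynamics, both of probability \<open>0\<close>: a site
  of value exactly \<open>1\<close> would topple at its own time without a toppled mother, and a site of negative
  value could be brought to \<open>0\<close> by its mother.\<close>

context
  fixes b :: nat and v :: real and X :: "nat list \<Rightarrow> real"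
  assumes X: "\<And>\<sigma>. \<sigma> \<in> tree b \<Longrightarrow> 0 \<le> X \<sigma> \<and> X \<sigma> < 1"
begin

lemma process_before: "t < length \<sigma> \<Longrightarrow> process b v X t \<sigma> = X \<sigma>"
  by (induction t) auto

text \<open>The two claims feed each other: the value of a site at its own time depends on whether its
  mother reached \<open>1\<close> one step earlier.\<close>

lemma process_own_time:
  assumes "\<sigma> \<in> tree b"
  shows "process b v X (length \<sigma>) \<sigma> =
    (if \<sigma> = [] \<or> toppled b (X [] + v) X (butlast \<sigma>) then total b (X [] + v) X \<sigma> else X \<sigma>)
   \<and> (1 \<le> process b v X (length \<sigma>) \<sigma> \<longleftrightarrow> toppled b (X [] + v) X \<sigma>)"
  using assms
proof (induction \<sigma> rule: rev_induct)
  case (snoc i \<sigma>)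
  let ?q = "X [] + v"
  have IH: "1 \<le> process b v X (length \<sigma>) \<sigma> \<longleftrightarrow> toppled b ?q X \<sigma>"
    and val: "toppled b ?q X \<sigma> \<Longrightarrow> process b v X (length \<sigma>) \<sigma> = total b ?q X \<sigma>"
    using snoc toppled_snoc[of b ?q X "butlast \<sigma>" "last \<sigma>"]
    by (auto simp: append_butlast_last_id split: if_splits)
  have "process b v X (length (\<sigma> @ [i])) (\<sigma> @ [i]) =
      (if toppled b ?q X \<sigma> then X (\<sigma> @ [i]) + process b v X (length \<sigma>) \<sigma> / real b else X (\<sigma> @ [i]))"
    using IH by (simp add: mother_def process_before)
  then have eq: "process b v X (length (\<sigma> @ [i])) (\<sigma> @ [i]) =
      (if toppled b ?q X \<sigma> then total b ?q X (\<sigma> @ [i]) else X (\<sigma> @ [i]))"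
    using val by (simp add: total_snoc)
  show ?case using eq X[OF snoc.prems] by (auto simp: toppled_snoc)
qed simp

lemma process_after:
  assumes "\<sigma> \<in> tree b"
  shows "process b v X (length \<sigma> + Suc k) \<sigma> =
    (if toppled b (X [] + v) X \<sigma> then 0 else process b v X (length \<sigma>) \<sigma>)"
  using process_own_time[OF assms] by (induction k) auto

text \<open>A toppled site has load at least \<open>1\<close> before it is emptied. A site that does not topple changes
  its value at most once, from \<open>X \<sigma> \<ge> 0\<close> to something at least as large, and so never passes
  from a nonzero value to \<open>0\<close>.\<close>

lemma avalanche_eq_toppled: "avalanche b v X = {\<sigma> \<in> tree b. toppled b (X [] + v) X \<sigma>}"
proof (intro equalityI subsetI)
  fix \<sigma> assume "\<sigma> \<in> {\<sigma> \<in> tree b. toppled b (X [] + v) X \<sigma>}"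
  then have \<sigma>: "\<sigma> \<in> tree b" "toppled b (X [] + v) X \<sigma>" by auto
  have "process b v X (Suc (length \<sigma>)) \<sigma> = 0" using process_after[OF \<sigma>(1), of 0] \<sigma>(2) by simp
  moreover have "process b v X (length \<sigma>) \<sigma> \<noteq> 0" using process_own_time[OF \<sigma>(1)] \<sigma>(2) by auto
  ultimately show "\<sigma> \<in> avalanche b v X"
    using \<sigma>(1) unfolding avalanche_def
    by (intro UN_I[of "Suc (length \<sigma>)"] UNIV_I CollectI conjI exI[of _ "length \<sigma>"]) auto
next
  fix \<sigma> assume "\<sigma> \<in> avalanche b v X"
  then obtain t s where \<sigma>: "\<sigma> \<in> tree b" and t: "process b v X t \<sigma> = 0" "s < t" "process b v X s \<sigma> \<noteq> 0"
    by (auto simp: avalanche_def)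
  have "toppled b (X [] + v) X \<sigma>"
  proof (rule ccontr)
    let ?w = "process b v X (length \<sigma>) \<sigma>"
    assume nt: "\<not> ?thesis"
    have late: "process b v X r \<sigma> = ?w" if "length \<sigma> \<le> r" for r
      using process_after[OF \<sigma>, of "r - Suc (length \<sigma>)"] nt that by (cases "r = length \<sigma>") auto
    have ts: "length \<sigma> \<le> t" "s < length \<sigma>"
      using t late[of t] late[of s] process_before[of t \<sigma>] process_before[of s \<sigma>]
      by (metis leI less_trans)+
    have w: "?w = 0" using late[OF ts(1)] t by simp
    have Xs: "X \<sigma> \<noteq> 0" using t process_before[OF ts(2)] by simp
    have ne: "\<sigma> \<noteq> []" using ts by auto
    have tb: "toppled b (X [] + v) X (butlast \<sigma>)"
      using process_own_time[OF \<sigma>] w Xs ne by (auto split: if_splits)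
    then have "?w = X \<sigma> + total b (X [] + v) X (butlast \<sigma>) / real b"
      using process_own_time[OF \<sigma>] ne total_snoc[of b "X [] + v" X "butlast \<sigma>" "last \<sigma>"] by simp
    moreover have "0 \<le> total b (X [] + v) X (butlast \<sigma>) / real b"
      using toppled_imp_total[OF tb] by simp
    ultimately show False using w Xs X[OF \<sigma>] by linarith
  qed
  with \<sigma> show "\<sigma> \<in> {\<sigma> \<in> tree b. toppled b (X [] + v) X \<sigma>}" by simp
qed

end

lemma countable_tree: "countable (tree b)"
  by (rule countableI_type)

section \<open>Infinite products of one law\<close>

context prob_space
begin

text \<open>Fubini for a single coordinate: given its value, the others keep their product law.\<close>

lemma measure_PiM_insert:
  assumes i: "i \<notin> I" and A: "A \<in> sets (PiM (insert i I) (\<lambda>_. M))"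
  shows "measure (PiM (insert i I) (\<lambda>_. M)) A =
    (\<integral>x. measure (PiM I (\<lambda>_. M)) {X \<in> space (PiM I (\<lambda>_. M)). X(i := x) \<in> A} \<partial>M)"
proof -
  interpret N: prob_space "PiM I (\<lambda>_. M)" by (intro prob_space_PiM prob_space_axioms)
  let ?N = "PiM I (\<lambda>_. M)" and ?f = "\<lambda>(x, X). X(i := x)"
  have f: "?f \<in> measurable (M \<Otimes>\<^sub>M ?N) (PiM (insert i I) (\<lambda>_. M))"
    by measurable
  let ?B = "?f -` A \<inter> space (M \<Otimes>\<^sub>M ?N)"
  have B: "?B \<in> sets (M \<Otimes>\<^sub>M ?N)" using f A by (rule measurable_sets)
  have sec: "Pair x -` ?B = {X \<in> space ?N. X(i := x) \<in> A}" if "x \<in> space M" for x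
    using that by (auto simp: space_pair_measure)
  have "measure (PiM (insert i I) (\<lambda>_. M)) A = measure (distr (M \<Otimes>\<^sub>M ?N) (PiM (insert i I) (\<lambda>_. M)) ?f) A"
    by (subst distr_pair_PiM_eq_PiM) (auto simp: prob_space_axioms)
  also have "\<dots> = measure (M \<Otimes>\<^sub>M ?N) ?B" using f A by (rule measure_distr)
  also have "\<dots> = enn2real (\<integral>\<^sup>+x. emeasure ?N (Pair x -` ?B) \<partial>M)"
    unfolding measure_def by (subst N.emeasure_pair_measure_alt[OF B]) simp
  also have "(\<integral>\<^sup>+x. emeasure ?N (Pair x -` ?B) \<partial>M) = (\<integral>\<^sup>+x. ennreal (measure ?N (Pair x -` ?B)) \<partial>M)"
    by (simp add: N.emeasure_eq_measure)
  also have "enn2real \<dots> = (\<integral>x. measure ?N (Pair x -` ?B) \<partial>M)"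
    by (rule integral_eq_nn_integral[symmetric])
       (use N.measurable_emeasure_Pair[OF B] in \<open>auto simp: measure_def\<close>)
  also have "\<dots> = (\<integral>x. measure ?N {X \<in> space ?N. X(i := x) \<in> A} \<partial>M)"
    using sec by (intro Bochner_Integration.integral_cong) auto
  finally show ?thesis .
qed

lemma measure_PiM_reindex:
  assumes "inj_on f J" "f \<in> J \<rightarrow> K" "A \<in> sets (PiM J (\<lambda>_. M))"
  shows "measure (PiM K (\<lambda>_. M)) {X \<in> space (PiM K (\<lambda>_. M)). (\<lambda>j\<in>J. X (f j)) \<in> A}
    = measure (PiM J (\<lambda>_. M)) A"
proof -
  have m: "(\<lambda>X. \<lambda>j\<in>J. X (f j)) \<in> measurable (PiM K (\<lambda>_. M)) (PiM J (\<lambda>_. M))"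
    using assms(2) by (intro measurable_restrict measurable_component_singleton) auto
  have "measure (PiM J (\<lambda>_. M)) A =
      measure (distr (PiM K (\<lambda>_. M)) (PiM J (\<lambda>_. M)) (\<lambda>X. \<lambda>j\<in>J. X (f j))) A"
    using distr_PiM_reindex[of K "\<lambda>_. M", OF _ assms(1,2)] prob_space_axioms by simp
  also have "\<dots> = measure (PiM K (\<lambda>_. M)) ((\<lambda>X. \<lambda>j\<in>J. X (f j)) -` A \<inter> space (PiM K (\<lambda>_. M)))"
    using m assms(3) by (rule measure_distr)
  also have "(\<lambda>X. \<lambda>j\<in>J. X (f j)) -` A \<inter> space (PiM K (\<lambda>_. M))
      = {X \<in> space (PiM K (\<lambda>_. M)). (\<lambda>j\<in>J. X (f j)) \<in> A}" by auto
  finally show ?thesis by simp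
qed

lemma indep_vars_PiM_components:
  assumes "I \<noteq> {}"
  shows "prob_space.indep_vars (PiM I (\<lambda>_. M)) (\<lambda>_. M) (\<lambda>i X. X i) I"
proof -
  interpret N: prob_space "PiM I (\<lambda>_. M)" by (intro prob_space_PiM prob_space_axioms)
  have "distr (PiM I (\<lambda>_. M)) (PiM I (\<lambda>_. M)) (\<lambda>X. \<lambda>i\<in>I. X i) = PiM I (\<lambda>_. M)"
    using distr_PiM_reindex[of I "\<lambda>_. M" "\<lambda>i. i" I] prob_space_axioms by auto
  also have "\<dots> = PiM I (\<lambda>i. distr (PiM I (\<lambda>_. M)) M (\<lambda>X. X i))"
    by (intro PiM_cong refl distr_PiM_component[symmetric] prob_space_axioms)
  finally show ?thesis
    by (subst N.indep_vars_iff_distr_eq_PiM'[OF assms]) auto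
qed

end

section \<open>The linear and the branching recursion\<close>

text \<open>The functions of the load on which both recursions act. Monotonicity makes them measurable
  and lets loads be compared; the bounds make them integrable.\<close>

definition profile :: "(real \<Rightarrow> real) \<Rightarrow> bool" where
  "profile f \<longleftrightarrow> mono f \<and> (\<forall>q. 0 \<le> f q \<and> f q \<le> 1)"

lemma profileD:
  assumes "profile f"
  shows "x \<le> y \<Longrightarrow> f x \<le> f y" "0 \<le> f x" "f x \<le> 1" "f \<in> borel_measurable borel"
  using assms by (auto simp: profile_def mono_def intro!: borel_measurable_mono)

lemma profile_scale:
  assumes "profile f" "0 \<le> p" "p \<le> 1"
  shows "profile (\<lambda>q. p * f q)"
  using assms by (auto simp: profile_def mono_def mult_left_mono mult_le_one)

definition alive :: "real \<Rightarrow> real" where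
  "alive q = (if 1 \<le> q then 1 else 0)"

lemma profile_alive: "profile alive"
  by (auto simp: profile_def mono_def alive_def)

lemma Q_0 [simp]: "Q b \<theta> X 0 = \<theta>"
  by (simp add: Q_def)

text \<open>The recursion by the first innovation, whereas the definition expands from the last one.\<close>

lemma Q_Suc:
  "Q b \<theta> X (Suc k) = Q b (X 1 + \<theta> / real b) (\<lambda>j. X (Suc j)) k"
proof -
  have "(\<Sum>j=1..Suc k. X j / real b ^ (Suc k - j))
      = X 1 / real b ^ k + (\<Sum>j=Suc 1..Suc k. X j / real b ^ (Suc k - j))"
    by (subst sum.atLeast_Suc_atMost) auto
  also have "(\<Sum>j=Suc 1..Suc k. X j / real b ^ (Suc k - j)) = (\<Sum>j=1..k. X (Suc j) / real b ^ (k - j))"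
    by (subst sum.shift_bounds_cl_Suc_ivl) simp
  finally show ?thesis by (simp add: Q_def add_divide_distrib)
qed

lemma Q_cong: "(\<And>j. 1 \<le> j \<Longrightarrow> X j = Y j) \<Longrightarrow> Q b \<theta> X k = Q b \<theta> Y k"
  by (simp add: Q_def)

locale avalanche_model =
  fixes b :: nat and \<rho> :: "real measure"
  assumes b_gt_1: "b > 1" and flat: "\<rho> \<in> M_flat b"
begin

sublocale prob_space \<rho>
  using flat by (simp add: M_flat_def)

lemma sets_rho [simp]: "sets \<rho> = sets borel"
  using flat by (simp add: M_flat_def)

lemma space_rho [simp]: "space \<rho> = UNIV"
  using sets_eq_imp_space_eq[OF sets_rho] by simp

lemma rho_unit: "measure \<rho> {0..1} = 1"
  using flat by (simp add: M_flat_def)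

lemma AE_unit: "AE x in \<rho>. x \<in> {0..1}"
  using rho_unit by (subst prob_eq_1[symmetric]) auto

lemma rho_point [simp]: "measure \<rho> {x} = 0"
proof -
  obtain \<phi> :: "real \<Rightarrow> ennreal" where \<phi>: "\<phi> \<in> borel_measurable lborel" "\<rho> = density lborel \<phi>"
    using flat by (auto simp: M_flat_def)
  have "AE y in lborel. y \<notin> {x}"
    by (rule AE_not_in) (auto simp: null_sets_def)
  then have "emeasure \<rho> {x} = 0"
    unfolding \<phi>(2) using \<phi>(1) by (subst emeasure_density) (auto simp: nn_integral_0_iff_AE)
  then show ?thesis by (simp add: measure_def)
qed

lemma AE_neq: "AE x in \<rho>. x \<noteq> c"
  by (rule AE_I[where N="{c}"]) (auto simp: emeasure_eq_measure)

lemma AE_less_1: "AE x in \<rho>. x < 1"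
  using AE_unit AE_neq[of 1] by eventually_elim auto

text \<open>\<open>avg f q\<close> is the mean of \<open>f\<close> at the load that a site of load \<open>q\<close> passes on to one child.
  \<open>line\<close> follows one child, \<open>branch\<close> asks for success in at least one of \<open>b\<close> independent children.\<close>

definition avg :: "(real \<Rightarrow> real) \<Rightarrow> real \<Rightarrow> real" where
  "avg f q = (\<integral>x. f (x + q / real b) \<partial>\<rho>)"

definition line :: "(real \<Rightarrow> real) \<Rightarrow> real \<Rightarrow> real" where
  "line f q = (if 1 \<le> q then avg f q else 0)"

definition branch :: "(real \<Rightarrow> real) \<Rightarrow> real \<Rightarrow> real" where
  "branch f q = (if 1 \<le> q then 1 - (1 - avg f q) ^ b else 0)"

lemma integrable_profile:
  assumes "profile f" shows "integrable \<rho> (\<lambda>x. f (x + c))"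
proof (rule integrable_const_bound[where B=1])
  show "AE x in \<rho>. norm (f (x + c)) \<le> 1"
    using profileD(2,3)[OF assms] by (intro AE_I2) simp
  have [measurable]: "f \<in> borel_measurable borel" by (rule profileD(4)[OF assms])
  have "(\<lambda>x. f (x + c)) \<in> borel_measurable borel" by measurable
  then show "(\<lambda>x. f (x + c)) \<in> borel_measurable \<rho>"
    using measurable_cong_sets[OF sets_rho refl] by blast
qed

lemma avg_mono:
  assumes "profile f" "profile g" "\<And>x. f x \<le> g x" "q \<le> r"
  shows "avg f q \<le> avg g r"
  unfolding avg_def
proof (rule integral_mono[OF integrable_profile integrable_profile])
  fix x
  have "f (x + q / b) \<le> f (x + r / b)"
    using assms(4) by (intro profileD(1)[OF assms(1)]) (simp add: divide_right_mono)
  then show "f (x + q / b) \<le> g (x + r / b)" by (rule order_trans[OF _ assms(3)])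
qed fact+

lemma avg_nonneg:
  assumes "profile f" shows "0 \<le> avg f q"
  unfolding avg_def by (intro integral_nonneg_AE AE_I2 profileD(2)[OF assms])

lemma avg_le_1:
  assumes "profile f" shows "avg f q \<le> 1"
proof -
  have "avg f q \<le> (\<integral>x. 1 \<partial>\<rho>)"
    unfolding avg_def
    by (intro integral_mono integrable_profile[OF assms]) (auto simp: profileD(3)[OF assms])
  then show ?thesis by (simp add: prob_space[simplified])
qed

lemma avg_scale: "avg (\<lambda>q. c * f q) q = c * avg f q"
  by (simp add: avg_def)

lemma line_scale: "line (\<lambda>q. c * f q) = (\<lambda>q. c * line f q)"
  by (auto simp: line_def avg_scale)

lemma line_pow_scale: "(line ^^ n) (\<lambda>q. c * f q) = (\<lambda>q. c * (line ^^ n) f q)"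
  by (induction n) (simp_all add: line_scale)

lemma profile_line: "profile f \<Longrightarrow> profile (line f)"
  unfolding profile_def[of "line f"] mono_def
  by (auto simp: line_def avg_nonneg avg_le_1 avg_mono)

lemma profile_branch: "profile f \<Longrightarrow> profile (branch f)"
  unfolding profile_def[of "branch f"] mono_def
  by (auto simp: branch_def avg_nonneg avg_le_1 avg_mono power_le_one intro!: power_mono)

lemma profile_line_pow: "profile f \<Longrightarrow> profile ((line ^^ n) f)"
  by (induction n) (auto simp: profile_line)

lemma profile_branch_pow: "profile f \<Longrightarrow> profile ((branch ^^ n) f)"
  by (induction n) (auto simp: profile_branch)

lemma line_mono:
  assumes "profile f" "profile g" "\<And>x. f x \<le> g x"
  shows "line f q \<le> line g q"
  using assms by (auto simp: line_def avg_mono)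

lemma branch_mono:
  assumes "profile f" "profile g" "\<And>x. f x \<le> g x"
  shows "branch f q \<le> branch g q"
  using assms by (auto simp: branch_def avg_mono avg_le_1 intro!: power_mono)

lemma line_pow_mono:
  assumes "profile f" "profile g" "\<And>x. f x \<le> g x"
  shows "(line ^^ n) f q \<le> (line ^^ n) g q"
  by (induction n arbitrary: q) (auto intro!: line_mono profile_line_pow assms)

lemma branch_pow_mono:
  assumes "profile f" "profile g" "\<And>x. f x \<le> g x"
  shows "(branch ^^ n) f q \<le> (branch ^^ n) g q"
  by (induction n arbitrary: q) (auto intro!: branch_mono profile_branch_pow assms)

lemma line_le_branch:
  assumes "profile f" shows "line f q \<le> branch f q"
proof -
  have "(1 - avg f q) ^ b \<le> (1 - avg f q) ^ 1"
    using b_gt_1 avg_nonneg[OF assms] avg_le_1[OF assms] by (intro power_decreasing) auto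
  then show ?thesis by (simp add: line_def branch_def)
qed

lemma line_pow_le_branch_pow:
  assumes "profile f" shows "(line ^^ n) f q \<le> (branch ^^ n) f q"
proof (induction n arbitrary: q)
  case (Suc n)
  have "line ((line ^^ n) f) q \<le> line ((branch ^^ n) f) q"
    by (intro line_mono profile_line_pow profile_branch_pow assms Suc)
  also have "\<dots> \<le> branch ((branch ^^ n) f) q"
    by (intro line_le_branch profile_branch_pow assms)
  finally show ?case by simp
qed simp

text \<open>This is \<open>1 - (1 - x)\<^sup>b \<le> (b - x) x\<close> on \<open>[0,1]\<close>. The gain of \<open>x\<close> over the union bound \<open>b x\<close>
  is what settles the critical case.\<close>

lemma branch_upper:
  assumes "profile f"
  shows "branch f q \<le> (real b - avg f q) * line f q"
proof -
  define x where "x = avg f q"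
  have x: "0 \<le> x" "x \<le> 1" using avg_nonneg[OF assms] avg_le_1[OF assms] by (auto simp: x_def)
  have "1 - (real n - x) * x \<le> (1 - x) ^ n" if "n \<ge> 2" for n
    using that
  proof (induction n rule: nat_induct_at_least)
    case base
    then show ?case by (simp add: power2_eq_square algebra_simps)
  next
    case (Suc n)
    have "x * (1 - x) ^ n \<le> x" using x by (intro mult_left_le) (auto simp: power_le_one)
    then show ?case using Suc by (simp add: algebra_simps)
  qed
  from this[of b] have "1 - (real b - x) * x \<le> (1 - x) ^ b" using b_gt_1 by simp
  then show ?thesis
    using b_gt_1 by (auto simp: line_def branch_def x_def[symmetric])
qed

text \<open>For small success probabilities the union bound is sharp up to a factor close to \<open>1\<close>.\<close>

lemma branch_lower:
  assumes "profile f" "\<And>q. f q \<le> e" "e * real b \<le> 1"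
  shows "(1 - real b * e) * (real b * line f q) \<le> branch f q"
proof -
  define x where "x = avg f q"
  have x: "0 \<le> x" "x \<le> 1" using avg_nonneg[OF assms(1)] avg_le_1[OF assms(1)] by (auto simp: x_def)
  have "x \<le> (\<integral>x. e \<partial>\<rho>)" unfolding x_def avg_def
    using assms(2) by (intro integral_mono integrable_profile[OF assms(1)]) auto
  then have xe: "x \<le> e" by (simp add: prob_space[simplified])
  have "(1 - x) ^ n \<le> 1 - real n * x + real n ^ 2 * x\<^sup>2" for n
  proof (induction n)
    case (Suc n)
    have "(1 - x) ^ Suc n \<le> (1 - x) * (1 - real n * x + real n ^ 2 * x\<^sup>2)"
      using x Suc by (auto intro!: mult_left_mono)
    also have "\<dots> = 1 - real (Suc n) * x + (real n + real n ^ 2) * x\<^sup>2 - real n ^ 2 * x ^ 3"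
      by (simp add: power2_eq_square power3_eq_cube algebra_simps)
    also have "\<dots> \<le> 1 - real (Suc n) * x + (real (Suc n) ^ 2) * x\<^sup>2"
    proof -
      have "(real n + real n ^ 2) * x\<^sup>2 \<le> (real (Suc n) ^ 2) * x\<^sup>2"
        by (intro mult_right_mono) (auto simp: power2_eq_square algebra_simps)
      moreover have "0 \<le> real n ^ 2 * x ^ 3" using x by simp
      ultimately show ?thesis by linarith
    qed
    finally show ?case .
  qed simp
  then have "real b * x - real b ^ 2 * x\<^sup>2 \<le> 1 - (1 - x) ^ b" by (smt (verit))
  moreover have "(1 - real b * e) * (real b * x) \<le> (1 - real b * x) * (real b * x)"
    using x xe by (intro mult_right_mono) (auto intro: mult_left_mono)
  ultimately show ?thesis
    by (auto simp: line_def branch_def x_def[symmetric] power2_eq_square algebra_simps)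
qed

section \<open>The top of the law\<close>

abbreviation "xstar \<equiv> x_star \<rho>"

lemma measure_atLeast_1: "measure \<rho> {y..1} = measure \<rho> {y..}"
proof (rule measure_eq_AE)
  show "AE x in \<rho>. x \<in> {y..1} \<longleftrightarrow> x \<in> {y..}"
    using AE_unit by eventually_elim auto
qed auto

lemma below_x_star:
  assumes "y < xstar" shows "0 < measure \<rho> {y..}"
proof -
  let ?S = "{y \<in> {0..1}. measure \<rho> {y..1} > 0}"
  have "0 \<in> ?S" using rho_unit by simp
  then obtain y' where y': "y' \<in> ?S" "y < y'"
    using less_cSupE[OF assms[unfolded x_star_def]] by blast
  have "measure \<rho> {y'..} \<le> measure \<rho> {y..}"
    using y' by (intro finite_measure_mono) auto
  with y' show ?thesis by (simp add: measure_atLeast_1)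
qed

lemma AE_le_x_star: "AE x in \<rho>. x \<le> xstar"
proof -
  let ?S = "{y \<in> {0..1}. measure \<rho> {y..1} > 0}"
  have xs0: "0 \<le> xstar" unfolding x_star_def using rho_unit by (intro cSup_upper) (auto intro: bdd_aboveI[of _ 1])
  have *: "measure \<rho> {y..} = 0" if "y > xstar" for y
  proof (rule ccontr)
    assume ne: "measure \<rho> {y..} \<noteq> 0"
    have "y \<le> 1"
    proof (rule ccontr)
      assume "\<not> y \<le> 1"
      then have "measure \<rho> {y..1} = 0" by simp
      with ne show False by (simp add: measure_atLeast_1)
    qed
    with ne that xs0 have "y \<in> ?S" by (simp add: measure_atLeast_1 zero_less_measure_iff)
    then have "y \<le> xstar" unfolding x_star_def by (intro cSup_upper) (auto intro: bdd_aboveI[of _ 1])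
    with that show False by simp
  qed
  have "AE x in \<rho>. \<forall>n. \<not> x \<ge> xstar + 1 / real (Suc n)"
    unfolding AE_all_countable
  proof
    fix n
    have "measure \<rho> {xstar + 1 / real (Suc n)..} = 0" by (rule *) simp
    then show "AE x in \<rho>. \<not> x \<ge> xstar + 1 / real (Suc n)"
      by (intro AE_I[where N="{xstar + 1 / real (Suc n)..}"]) (auto simp: emeasure_eq_measure sets_rho)
  qed
  then show ?thesis
  proof eventually_elim
    case (elim x)
    show ?case
    proof (rule ccontr)
      assume "\<not> x \<le> xstar"
      then obtain n where "1 / real (Suc n) < x - xstar"
        using reals_Archimedean[of "x - xstar"] by (auto simp: inverse_eq_divide)
      with elim show False by (auto simp: not_le dest: spec[of _ n])
    qed
  qed
qed

text \<open>Without atoms, the mass on \<open>[1 - 1/b, 1]\<close> cannot sit at its left end point.\<close>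

lemma x_star_gt: "1 - 1 / real b < xstar"
proof (rule ccontr)
  assume "\<not> ?thesis"
  then have "AE x in \<rho>. x \<notin> {1 - 1 / real b..1}"
    using AE_le_x_star AE_neq[of "1 - 1 / real b"] by auto
  then have "measure \<rho> {1 - 1 / real b..1} = 0"
    by (subst prob_eq_0) auto
  then show False using flat by (simp add: M_flat_def)
qed

lemma top_mass_small:
  assumes "0 < \<eta>"
  obtains \<epsilon> where "0 < \<epsilon>" "measure \<rho> {xstar - \<epsilon>..} < \<eta>"
proof -
  have "(\<lambda>n. measure \<rho> {xstar - 1 / real (Suc n)..}) \<longlonglongrightarrow> measure \<rho> (\<Inter>n. {xstar - 1 / real (Suc n)..})"
    by (rule finite_Lim_measure_decseq)
       (auto simp: decseq_def field_simps intro: order_trans[rotated])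
  moreover have "(\<Inter>n. {xstar - 1 / real (Suc n)..}) = {xstar..}"
  proof (intro equalityI subsetI)
    fix x assume x: "x \<in> (\<Inter>n. {xstar - 1 / real (Suc n)..})"
    show "x \<in> {xstar..}"
    proof (rule ccontr)
      assume "x \<notin> {xstar..}"
      then obtain n where "1 / real (Suc n) < xstar - x"
        using reals_Archimedean[of "xstar - x"] by (auto simp: inverse_eq_divide)
      with x show False by (auto dest: spec[of _ n])
    qed
  qed (auto intro: order_trans[rotated])
  moreover have "measure \<rho> {xstar..} = measure \<rho> {xstar}"
    using AE_le_x_star by (intro measure_eq_AE) auto
  ultimately have "(\<lambda>n. measure \<rho> {xstar - 1 / real (Suc n)..}) \<longlonglongrightarrow> 0" by simp
  from order_tendstoD(2)[OF this assms] obtain n where "measure \<rho> {xstar - 1 / real (Suc n)..} < \<eta>"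
    by (auto simp: eventually_sequentially)
  then show ?thesis by (intro that[of "1 / real (Suc n)"]) auto
qed

text \<open>The fixed point of \<open>q \<mapsto> x\<^sub>\<star> + q / b\<close>: loads above it can only decrease towards it
  or drop below it.\<close>

definition q_star :: real where "q_star = xstar * real b / (real b - 1)"

lemma q_star_fixed: "xstar + q_star / real b = q_star"
  using b_gt_1 by (simp add: q_star_def field_simps)

lemma q_star_gt_1: "1 < q_star"
  using x_star_gt b_gt_1 by (simp add: q_star_def field_simps)

text \<open>If all innovations are at least \<open>y\<close>, loads dominate the orbit of \<open>q \<mapsto> y + q / b\<close>, which
  increases from \<open>1\<close> to its fixed point \<open>t\<close>. Every \<open>t\<close> between \<open>1\<close> and \<open>q_star\<close> arises from some
  \<open>y < x\<^sub>\<star>\<close>, below which innovations stay with probability less than \<open>1\<close>. The constants \<open>m\<close>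
  and \<open>p\<close> come before \<open>g\<close>, since they have to serve a whole sequence of iterates.\<close>

lemma reach:
  assumes "\<theta> < q_star"
  obtains m p where "0 < p" "\<And>g. profile g \<Longrightarrow> p * g \<theta> \<le> (line ^^ m) g 1"
proof -
  have B: "real b > 1" using b_gt_1 by simp
  define t where "t = (max \<theta> 1 + q_star) / 2"
  have t: "\<theta> < t" "1 < t" "t < q_star" using assms q_star_gt_1 by (auto simp: t_def)
  \<comment> \<open>chosen such that \<open>t = y + t / b\<close>\<close>
  define y where "y = t - t / real b"
  have "y < xstar"
  proof -
    have "t * (1 - 1 / real b) < q_star * (1 - 1 / real b)" using t B by (intro mult_strict_right_mono) auto
    then show ?thesis using q_star_fixed by (simp add: y_def algebra_simps)
  qed
  define p0 where "p0 = measure \<rho> {y..}"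
  have p0: "0 < p0" using below_x_star[OF \<open>y < xstar\<close>] by (simp add: p0_def)
  define h where "h q = y + q / real b" for q
  have h: "h q = t - (t - q) / real b" for q by (simp add: h_def y_def diff_divide_distrib)
  have h1: "1 \<le> h q" if "1 \<le> q" for q
  proof -
    have "t * (real b - 1) \<ge> 1 * (real b - 1)" using t B by (intro mult_right_mono) auto
    then show ?thesis using that B unfolding h by (simp add: field_simps)
  qed
  have step: "p0 * g (h q) \<le> line g q" if g: "profile g" and q: "1 \<le> q" for g q
  proof -
    have "p0 * g (h q) = (\<integral>x. indicator {y..} x * g (h q) \<partial>\<rho>)"
      by (simp add: p0_def)
    also have "\<dots> \<le> avg g q" unfolding avg_def
    proof (rule integral_mono)
      show "integrable \<rho> (\<lambda>x. indicator {y..} x * g (h q))"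
        by (intro integrable_mult_left) (auto simp: integrable_indicator_iff emeasure_eq_measure)
      show "integrable \<rho> (\<lambda>x. g (x + q / real b))" by (rule integrable_profile[OF g])
      fix x
      show "indicator {y..} x * g (h q) \<le> g (x + q / real b)"
        by (auto simp: indicator_def h_def profileD(2)[OF g] intro!: profileD(1)[OF g])
    qed
    finally show ?thesis using q by (simp add: line_def)
  qed
  have iter: "p0 ^ m * g ((h ^^ m) q) \<le> (line ^^ m) g q" if g: "profile g" and q: "1 \<le> q" for g q m
    using q
  proof (induction m arbitrary: q)
    case (Suc m)
    have "p0 ^ Suc m * g ((h ^^ Suc m) q) = p0 * (p0 ^ m * g ((h ^^ m) (h q)))"
      by (simp add: funpow_swap1)
    also have "\<dots> \<le> p0 * (line ^^ m) g (h q)"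
      using p0 Suc.IH[OF h1[OF Suc.prems]] by (intro mult_left_mono) auto
    also have "\<dots> \<le> line ((line ^^ m) g) q"
      by (rule step[OF profile_line_pow[OF g] Suc.prems])
    finally show ?case by simp
  qed simp
  have hm: "(h ^^ m) 1 = t - (t - 1) / real b ^ m" for m
  proof (induction m)
    case (Suc m)
    have "(h ^^ Suc m) 1 = h (t - (t - 1) / real b ^ m)" by (simp add: Suc)
    also have "\<dots> = t - (t - 1) / real b ^ Suc m" unfolding h by simp
    finally show ?case .
  qed simp
  have "(\<lambda>m. t - (t - 1) * (1 / real b) ^ m) \<longlonglongrightarrow> t - (t - 1) * 0"
    using B by (intro tendsto_intros LIMSEQ_realpow_zero) auto
  from order_tendstoD(1)[OF this, of \<theta>] t obtain m where "\<theta> < t - (t - 1) * (1 / real b) ^ m"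
    by (auto simp: eventually_sequentially)
  then have m: "\<theta> < (h ^^ m) 1" by (simp add: hm power_one_over)
  show ?thesis
  proof (rule that[of "p0 ^ m" m])
    fix g assume g: "profile g"
    have "p0 ^ m * g \<theta> \<le> p0 ^ m * g ((h ^^ m) 1)"
      using m p0 by (intro mult_left_mono profileD(1)[OF g]) auto
    also have "\<dots> \<le> (line ^^ m) g 1" using iter[OF g, of 1] by simp
    finally show "p0 ^ m * g \<theta> \<le> (line ^^ m) g 1" .
  qed (use p0 in auto)
qed

text \<open>From load \<open>q_star + D\<close> the next load is at most \<open>q_star + D / b\<close>, and it is at most
  \<open>q_star - \<epsilon>\<close> unless the innovation lies within \<open>\<epsilon> + D / b\<close> of the top of its law.\<close>

lemma line_above_q_star:
  assumes g: "profile g"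
  shows "line g (q_star + D) \<le> g (q_star - \<epsilon>) + measure \<rho> {xstar - (\<epsilon> + D / real b)..} * g (q_star + D / real b)"
proof -
  let ?A = "{xstar - (\<epsilon> + D / real b)..}"
  have "avg g (q_star + D) \<le> (\<integral>x. g (q_star - \<epsilon>) + indicator ?A x * g (q_star + D / real b) \<partial>\<rho>)"
    unfolding avg_def
  proof (rule integral_mono_AE)
    show "AE x in \<rho>. g (x + (q_star + D) / real b)
        \<le> g (q_star - \<epsilon>) + indicator ?A x * g (q_star + D / real b)"
      using AE_le_x_star
    proof eventually_elim
      case (elim x)
      have eq: "x + (q_star + D) / real b = q_star - xstar + x + D / real b"
        using q_star_fixed by (simp add: add_divide_distrib)
      show ?case
      proof (cases "x \<in> ?A")
        case True
        have "g (x + (q_star + D) / real b) \<le> g (q_star + D / real b)"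
          unfolding eq using elim by (intro profileD(1)[OF g]) auto
        with True show ?thesis using profileD(2)[OF g, of "q_star - \<epsilon>"] by simp
      next
        case False
        then have "g (x + (q_star + D) / real b) \<le> g (q_star - \<epsilon>)"
          unfolding eq by (intro profileD(1)[OF g]) auto
        with False show ?thesis by simp
      qed
    qed
  qed (auto simp: integrable_profile[OF g] integrable_indicator_iff emeasure_eq_measure)
  also have "\<dots> = g (q_star - \<epsilon>) + measure \<rho> ?A * g (q_star + D / real b)"
    by (subst Bochner_Integration.integral_add)
       (auto simp: integrable_indicator_iff emeasure_eq_measure prob_space[simplified])
  finally show ?thesis
    using profileD(2)[OF g] by (auto simp: line_def)
qed

section \<open>The growth rate\<close>

text \<open>\<open>L n q\<close> will turn out to be \<open>Z b \<rho> n q\<close>, and \<open>S n q\<close> the probability that an avalanche with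
  root load \<open>q\<close> reaches depth \<open>n\<close>.\<close>

abbreviation "S n \<equiv> (branch ^^ n) alive"
abbreviation "L n \<equiv> (line ^^ n) alive"

lemma profile_L: "profile (L n)" and profile_S: "profile (S n)"
  by (simp_all add: profile_line_pow profile_branch_pow profile_alive)

text \<open>For loads slightly above \<open>q_star\<close> the influence of loads above \<open>q_star - \<epsilon>\<close> on one step of the
  recursion is a contraction with a factor \<open>\<eta>\<close> of choice.\<close>

lemma decomposition_bound:
  assumes "0 < \<eta>"
  obtains \<epsilon> where "0 < \<epsilon>"
    "\<And>g D. profile g \<Longrightarrow> 0 \<le> D \<Longrightarrow> D \<le> real b * \<epsilon> \<Longrightarrow>
       line g (q_star + D) \<le> g (q_star - \<epsilon>) + \<eta> * g (q_star + D)"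
proof -
  obtain d where d: "0 < d" "measure \<rho> {xstar - d..} < \<eta>" using top_mass_small[OF assms] .
  show ?thesis
  \<comment> \<open>one half of \<open>d\<close> is for \<open>\<epsilon>\<close>, the other for \<open>D / b \<le> \<epsilon>\<close>\<close>
  proof (rule that[of "d / 2"])
    fix g D assume g: "profile g" and D: "0 \<le> D" "D \<le> real b * (d / 2)"
    have Db: "D / real b \<le> d / 2" "D / real b \<le> D"
      using D b_gt_1 mult_left_mono[of 1 "real b" D] by (auto simp: field_simps)
    have "measure \<rho> {xstar - (d / 2 + D / real b)..} \<le> measure \<rho> {xstar - d..}"
      using Db by (intro finite_measure_mono) auto
    then have "measure \<rho> {xstar - (d / 2 + D / real b)..} * g (q_star + D / real b) \<le> \<eta> * g (q_star + D)"
      using d Db assms by (intro mult_mono profileD(1)[OF g]) (auto simp: profileD(2)[OF g])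
    then show "line g (q_star + D) \<le> g (q_star - d / 2) + \<eta> * g (q_star + D)"
      using line_above_q_star[OF g, of D "d / 2"] by linarith
  qed (use d in simp)
qed

text \<open>The excess over \<open>q_star\<close> shrinks by a factor \<open>b\<close> per generation, so a property of small
  excesses that is inherited backwards along this shrinking holds for every excess.\<close>

lemma induct_above_q_star:
  assumes \<epsilon>: "0 < \<epsilon>"
    and small: "\<And>D. 0 \<le> D \<Longrightarrow> D \<le> real b * \<epsilon> \<Longrightarrow> P D"
    and step: "\<And>D. 0 \<le> D \<Longrightarrow> P (D / real b) \<Longrightarrow> P D"
    and D: "0 \<le> D"
  shows "P D"
proof -
  have "P D" if "0 \<le> D" "D \<le> real b ^ k * (real b * \<epsilon>)" for D k
    using that
  proof (induction k arbitrary: D)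
    case (Suc k)
    then have "P (D / real b)" using b_gt_1 by (intro Suc.IH) (auto simp: field_simps)
    then show ?case using Suc.prems(1) by (rule step[rotated])
  qed (use small in simp)
  moreover obtain k where "D / (real b * \<epsilon>) < real b ^ k"
    using real_arch_pow[of "real b"] b_gt_1 by auto
  then have "D \<le> real b ^ k * (real b * \<epsilon>)" using b_gt_1 \<epsilon> by (simp add: field_simps)
  ultimately show ?thesis using D by blast
qed

lemma line_le_below:
  assumes "profile g" shows "line g (q_star + D) \<le> g (q_star - 1) + g (q_star + D / real b)"
proof -
  have "measure \<rho> {xstar - (1 + D / real b)..} * g (q_star + D / real b) \<le> 1 * g (q_star + D / real b)"
    by (intro mult_right_mono) (auto simp: profileD(2)[OF assms])
  then show ?thesis using line_above_q_star[OF assms, of D 1] by linarith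
qed

lemma alive_le_profile: "profile g \<Longrightarrow> g 1 * alive q \<le> g q"
  using profileD(1)[of g 1 q] profileD(2)[of g q] by (auto simp: alive_def)

text \<open>A line that survives \<open>n\<close> generations has load at least \<open>1\<close>, and more load helps.\<close>

lemma L_supermult: "L n 1 * L m 1 \<le> L (n + m) 1"
proof -
  have "L m 1 * L n 1 = (line ^^ n) (\<lambda>q. L m 1 * alive q) 1" by (simp add: line_pow_scale)
  also have "\<dots> \<le> (line ^^ n) (L m) 1"
    by (intro line_pow_mono profile_scale profile_alive profile_L alive_le_profile profileD(2)[OF profile_L] profileD(3)[OF profile_L])
  finally show ?thesis by (simp add: funpow_add mult.commute)
qed

lemma L_pow: "L m 1 ^ k \<le> L (k * m) 1"
proof (induction k)
  case (Suc k)
  have "L m 1 ^ Suc k \<le> L m 1 * L (k * m) 1"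
    using Suc by (auto intro: mult_left_mono profileD(2)[OF profile_L])
  also have "\<dots> \<le> L (Suc k * m) 1" using L_supermult[of m "k * m"] by simp
  finally show ?case .
qed (simp add: alive_def)

lemma L_1_pos: "0 < L 1 1"
proof -
  have "L 1 1 = (\<integral>x. indicator {1 - 1 / real b..} x \<partial>\<rho>)"
    by (auto simp: line_def avg_def alive_def indicator_def intro!: Bochner_Integration.integral_cong)
  also have "\<dots> = measure \<rho> {1 - 1 / real b..}" by simp
  finally show ?thesis using below_x_star[OF x_star_gt] by simp
qed

lemma L_pos: "0 < L n 1"
  using L_pow[of 1 n] L_1_pos by (simp del: One_nat_def) (meson less_le_trans zero_less_power)

definition rate :: real where "rate = (SUP n. root (Suc n) (L (Suc n) 1))"

lemma bdd_rate: "bdd_above (range (\<lambda>n. root (Suc n) (L (Suc n) 1)))"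
  by (rule bdd_aboveI[of _ 1]) (auto simp: profileD(3)[OF profile_L] simp del: funpow.simps)

lemma L_le_rate: "L n 1 \<le> rate ^ n"
proof (cases n)
  case (Suc k)
  have "root n (L n 1) \<le> rate"
    unfolding rate_def Suc by (rule cSUP_upper[OF UNIV_I bdd_rate])
  then have "root n (L n 1) ^ n \<le> rate ^ n"
    using Suc by (intro power_mono) (auto simp: less_imp_le[OF L_pos] simp del: funpow.simps)
  then show ?thesis using Suc by (simp add: less_imp_le[OF L_pos] del: funpow.simps power_Suc)
qed (simp add: alive_def)

lemma rate_pos: "0 < rate" and rate_le_1: "rate \<le> 1"
proof -
  show "0 < rate" using L_le_rate[of 1] L_1_pos by simp
  show "rate \<le> 1" unfolding rate_def
    by (rule cSUP_least) (auto simp: profileD(3)[OF profile_L] simp del: funpow.simps)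
qed

lemma rate_approx:
  assumes "w < rate"
  obtains m where "0 < m" "max w 0 ^ m < L m 1"
proof -
  obtain n where n: "w < root (Suc n) (L (Suc n) 1)"
    using assms unfolding rate_def by (subst (asm) less_cSUP_iff[OF _ bdd_rate]) auto
  have "max w 0 < root (Suc n) (L (Suc n) 1)"
    using n L_pos[of "Suc n"] by (auto simp del: funpow.simps)
  then have "max w 0 ^ Suc n < root (Suc n) (L (Suc n) 1) ^ Suc n"
    by (intro power_strict_mono) auto
  then have "max w 0 ^ Suc n < L (Suc n) 1"
    by (simp add: less_imp_le[OF L_pos] del: funpow.simps power_Suc)
  then show ?thesis by (rule that[rotated]) simp
qed

text \<open>Fekete's argument: split \<open>n\<close> into blocks of a length \<open>m\<close> with \<open>L m 1 \<ge> w\<^sup>m\<close> and a bounded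
  remainder.\<close>

lemma L_ge_rate:
  assumes "0 < w" "w < rate"
  obtains c where "0 < c" "\<And>n. c * w ^ n \<le> L n 1"
proof -
  obtain m where m: "0 < m" "w ^ m < L m 1" using rate_approx[OF assms(2)] assms(1) by auto
  have w1: "w \<le> 1" using assms rate_le_1 by simp
  have l1: "L 1 1 \<le> 1" by (rule profileD(3)[OF profile_L])
  show ?thesis
  proof (rule that[of "L 1 1 ^ m"])
    fix n
    have "L 1 1 ^ m * w ^ n \<le> L 1 1 ^ (n mod m) * w ^ (m * (n div m))"
      using assms w1 l1 m L_1_pos by (intro mult_mono power_decreasing) (auto simp del: funpow.simps One_nat_def intro: less_imp_le)
    also have "\<dots> \<le> L (n mod m * 1) 1 * L (n div m * m) 1"
      unfolding power_mult
      using m assms L_1_pos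
      by (intro mult_mono L_pow order_trans[OF power_mono L_pow]) (auto simp del: funpow.simps One_nat_def intro: less_imp_le L_pos)
    also have "\<dots> \<le> L n 1" using L_supermult[of "n mod m * 1" "n div m * m"] by (simp del: funpow.simps)
    finally show "L 1 1 ^ m * w ^ n \<le> L n 1" .
  qed (use L_1_pos in \<open>simp del: funpow.simps One_nat_def\<close>)
qed

lemma L_le_rate_below:
  assumes "\<theta> < q_star"
  obtains C where "0 < C" "\<And>n. L n \<theta> \<le> C * rate ^ n"
proof -
  obtain m p where p: "0 < p" "\<And>g. profile g \<Longrightarrow> p * g \<theta> \<le> (line ^^ m) g 1"
    using reach[OF assms] by blast
  show ?thesis
  proof (rule that[of "rate ^ m / p"])
    fix n
    have "p * L n \<theta> \<le> L (m + n) 1"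
      using p(2)[OF profile_L[of n]] by (simp add: funpow_add)
    also have "\<dots> \<le> rate ^ (m + n)" by (rule L_le_rate)
    finally show "L n \<theta> \<le> rate ^ m / p * rate ^ n"
      using p by (simp add: field_simps power_add)
  qed (use p rate_pos in simp)
qed

text \<open>If \<open>L n (q_star - \<epsilon>) \<le> C z\<^sup>n\<close>, then one step contracting by \<open>\<eta> = z / 2\<close> reproduces the
  bound \<open>K z\<^sup>n\<close> provided that \<open>C \<le> K z / 2\<close>. Excesses that are not small only cost a constant
  factor per generation.\<close>

lemma L_le_rate_above:
  assumes "0 \<le> D"
  shows "\<exists>C>0. \<forall>n. L n (q_star + D) \<le> C * rate ^ n"
proof -
  obtain \<epsilon> where \<epsilon>: "0 < \<epsilon>"
    "\<And>g D. profile g \<Longrightarrow> 0 \<le> D \<Longrightarrow> D \<le> real b * \<epsilon> \<Longrightarrow>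
       line g (q_star + D) \<le> g (q_star - \<epsilon>) + rate / 2 * g (q_star + D)"
    using decomposition_bound[of "rate / 2"] rate_pos by auto
  show ?thesis
  proof (rule induct_above_q_star[OF \<epsilon>(1) _ _ assms])
    fix D assume D: "0 \<le> D" "D \<le> real b * \<epsilon>"
    obtain C where C: "0 < C" "\<And>n. L n (q_star - \<epsilon>) \<le> C * rate ^ n"
      using L_le_rate_below[of "q_star - \<epsilon>"] \<epsilon>(1) by auto
    define K where "K = max 1 (2 * C / rate)"
    have K: "1 \<le> K" "C \<le> K * rate / 2" using rate_pos by (auto simp: K_def max_def field_simps)
    have "L n (q_star + D) \<le> K * rate ^ n" for n
    proof (induction n)
      case 0
      then show ?case using K by (auto simp: alive_def)
    next
      case (Suc n)
      have "L (Suc n) (q_star + D) \<le> L n (q_star - \<epsilon>) + rate / 2 * L n (q_star + D)"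
        using \<epsilon>(2)[OF profile_L D] by simp
      also have "\<dots> \<le> K * rate / 2 * rate ^ n + rate / 2 * (K * rate ^ n)"
      proof (intro add_mono mult_left_mono Suc)
        show "L n (q_star - \<epsilon>) \<le> K * rate / 2 * rate ^ n"
          using C(2)[of n] mult_right_mono[OF K(2) zero_le_power[OF less_imp_le[OF rate_pos]], of n]
          by linarith
      qed (use rate_pos in simp)
      also have "\<dots> = K * rate ^ Suc n" by simp
      finally show ?case .
    qed
    then show "\<exists>C>0. \<forall>n. L n (q_star + D) \<le> C * rate ^ n" using K by (intro exI[of _ K]) auto
  next
    fix D assume D: "0 \<le> D" and "\<exists>C>0. \<forall>n. L n (q_star + D / real b) \<le> C * rate ^ n"
    then obtain C where C: "0 < C" "\<And>n. L n (q_star + D / real b) \<le> C * rate ^ n" by blast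
    obtain C' where C': "0 < C'" "\<And>n. L n (q_star - 1) \<le> C' * rate ^ n"
      using L_le_rate_below[of "q_star - 1"] by auto
    have "L n (q_star + D) \<le> (1 + (C + C') / rate) * rate ^ n" for n
    proof (cases n)
      case 0
      have "0 < (C + C') / rate" using C C' rate_pos by simp
      then show ?thesis using 0 by (simp add: alive_def)
    next
      case (Suc k)
      have "L n (q_star + D) \<le> L k (q_star - 1) + L k (q_star + D / real b)"
        using line_le_below[OF profile_L] Suc by simp
      also have "\<dots> \<le> C' * rate ^ k + C * rate ^ k" by (intro add_mono C C')
      also have "\<dots> \<le> (1 + (C + C') / rate) * rate ^ n"
        using Suc rate_pos by (simp add: field_simps)
      finally show ?thesis .
    qed
    then show "\<exists>C>0. \<forall>n. L n (q_star + D) \<le> C * rate ^ n"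
      using C C' rate_pos by (intro exI[of _ "1 + (C + C') / rate"]) (auto intro: add_pos_nonneg)
  qed
qed

lemma tendsto_rate:
  assumes "1 \<le> \<theta>"
  shows "(\<lambda>n. root n (L n \<theta>)) \<longlonglongrightarrow> rate"
proof -
  obtain C where C: "0 < C" "\<And>n. L n \<theta> \<le> C * rate ^ n"
  proof (cases "\<theta> < q_star")
    case True
    then show ?thesis using L_le_rate_below that by blast
  next
    case False
    then show ?thesis using L_le_rate_above[of "\<theta> - q_star"] that by auto
  qed
  have up: "(\<lambda>n. root n (C * rate ^ n)) \<longlonglongrightarrow> rate"
  proof (rule Lim_transform_eventually)
    show "(\<lambda>n. root n C * rate) \<longlonglongrightarrow> rate"
      using tendsto_mult[OF LIMSEQ_root_const[OF C(1)] tendsto_const[of rate]] by simp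
    show "\<forall>\<^sub>F n in sequentially. root n C * rate = root n (C * rate ^ n)"
      using eventually_gt_at_top[of 0]
      by eventually_elim (use rate_pos in \<open>simp add: real_root_mult real_root_power_cancel\<close>)
  qed
  have le: "\<forall>\<^sub>F n in sequentially. root n (L n \<theta>) \<le> root n (C * rate ^ n)"
    using eventually_gt_at_top[of 0] by eventually_elim (use C in simp)
  show ?thesis
  proof (rule order_tendstoI)
    fix a assume "rate < a"
    from order_tendstoD(2)[OF up this] le
    show "\<forall>\<^sub>F n in sequentially. root n (L n \<theta>) < a" by eventually_elim simp
  next
    fix a assume "a < rate"
    define w where "w = (max a 0 + rate) / 2"
    have w: "0 < w" "w < rate" "a < w" using \<open>a < rate\<close> rate_pos by (auto simp: w_def max_def)
    obtain c where c: "0 < c" "\<And>n. c * w ^ n \<le> L n 1" using L_ge_rate[OF w(1,2)] by blast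
    have "(\<lambda>n. root n c * w) \<longlonglongrightarrow> w"
      using tendsto_mult[OF LIMSEQ_root_const[OF c(1)] tendsto_const[of w]] by simp
    from order_tendstoD(1)[OF this w(3)] eventually_gt_at_top[of 0]
    show "\<forall>\<^sub>F n in sequentially. a < root n (L n \<theta>)"
    proof eventually_elim
      case (elim n)
      have "c * w ^ n \<le> L n \<theta>" using c(2)[of n] profileD(1)[OF profile_L[of n] assms] by linarith
      then have "root n (c * w ^ n) \<le> root n (L n \<theta>)" using elim by simp
      moreover have "root n (c * w ^ n) = root n c * w"
        using elim w by (simp add: real_root_mult real_root_power_cancel)
      ultimately show ?case using elim by linarith
    qed
  qed
qed

end

section \<open>Extinction\<close>

text \<open>The limit \<open>l\<close> of a decreasing sequence of this kind satisfies \<open>0 \<le> l \<le> l / 2\<close>.\<close>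

lemma contraction_tendsto_0:
  fixes a c :: "nat \<Rightarrow> real"
  assumes "\<And>n. 0 \<le> a n" "\<And>n. a (Suc n) \<le> a n" "\<And>n. a (Suc n) \<le> c n + a n / 2" "c \<longlonglongrightarrow> 0"
  shows "a \<longlonglongrightarrow> 0"
proof -
  have "decseq a" using assms(2) by (simp add: decseq_Suc_iff)
  then obtain l where l: "a \<longlonglongrightarrow> l"
    using decseq_convergent[of a 0] assms(1) by blast
  have "l \<le> 0 + l / 2"
  proof (rule LIMSEQ_le)
    show "(\<lambda>n. a (Suc n)) \<longlonglongrightarrow> l" using l by (rule LIMSEQ_Suc)
    show "(\<lambda>n. c n + a n / 2) \<longlonglongrightarrow> 0 + l / 2" by (intro tendsto_intros assms l) simp
  qed (use assms in auto)
  moreover have "0 \<le> l" using assms(1) by (intro LIMSEQ_le_const[OF l]) auto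
  ultimately show ?thesis using l by simp
qed

context avalanche_model
begin

lemma branch_S: "branch (S n) = S (Suc n)" by simp

lemma S_antimono: "S (n + k) q \<le> S n q"
proof -
  have "S k q \<le> alive q" for q
    by (cases k) (auto simp: alive_def branch_def avg_le_1[OF profile_S] profileD(3)[OF profile_alive])
  then show ?thesis unfolding funpow_add o_apply
    by (intro branch_pow_mono profile_S profile_alive)
qed

text \<open>Suppose that \<open>S n 1\<close> stays above \<open>x > 0\<close>. A child of a toppled site then succeeds with
  probability at least \<open>c\<close>, namely \<open>x\<close> times the chance that it topples at all. By \<open>branch_upper\<close>
  the factor \<open>b\<close> of the union bound drops to \<open>b - c\<close>, and \<open>(b - c) z < 1\<close> for the rate \<open>z\<close>.\<close>

lemma S_tendsto_0_at_1:
  assumes "rate \<le> 1 / real b"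
  shows "(\<lambda>n. S n 1) \<longlonglongrightarrow> 0"
proof (rule decreasing_tendsto)
  show "\<forall>\<^sub>F n in sequentially. 0 \<le> S n 1" by (simp add: profileD(2)[OF profile_S])
  fix x :: real assume x: "0 < x"
  have "\<exists>N. S N 1 < x"
  proof (rule ccontr)
    assume "\<not> ?thesis"
    then have ge: "x \<le> S n 1" for n by (auto simp: not_less)
    define c where "c = x * L 1 1"
    have x1: "x \<le> 1" using ge[of 0] by (simp add: alive_def)
    have c: "0 < c" using x L_1_pos by (simp add: c_def)
    have c1: "c \<le> 1" unfolding c_def using x x1
      by (intro mult_le_one profileD(3)[OF profile_L] profileD(2)[OF profile_L])
    have avg_ge: "c \<le> avg (S n) q" if "1 \<le> q" for n q
    proof -
      have "c = line (\<lambda>q. x * alive q) 1" by (simp add: c_def line_scale)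
      also have "\<dots> = avg (\<lambda>q. x * alive q) 1" by (simp add: line_def)
      also have "\<dots> \<le> avg (S n) q"
      proof (rule avg_mono[OF _ profile_S _ that])
        show "profile (\<lambda>q. x * alive q)" using x x1 by (intro profile_scale profile_alive) auto
        fix y
        have "x * alive y \<le> S n 1 * alive y"
          by (intro mult_right_mono ge) (auto simp: alive_def)
        then show "x * alive y \<le> S n y" using alive_le_profile[OF profile_S[of n], of y] by linarith
      qed
      finally show ?thesis .
    qed
    have step: "S (Suc n) q \<le> (real b - c) * line (S n) q" for n q
    proof -
      have "(real b - avg (S n) q) * line (S n) q \<le> (real b - c) * line (S n) q"
        using avg_ge[of q n] profileD(2)[OF profile_line[OF profile_S[of n]], of q]
        by (cases "1 \<le> q") (auto intro: mult_right_mono simp: line_def)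
      then show ?thesis using branch_upper[OF profile_S[of n], of q] by simp
    qed
    have bc: "0 \<le> real b - c" using c1 b_gt_1 by simp
    have S_le: "S n q \<le> (real b - c) ^ n * L n q" for n q
    proof (induction n arbitrary: q)
      case (Suc n)
      have "line (S n) q \<le> (real b - c) ^ n * line (L n) q"
      proof (cases "1 \<le> q")
        case True
        have "avg (S n) q \<le> (\<integral>x. (real b - c) ^ n * L n (x + q / real b) \<partial>\<rho>)"
          unfolding avg_def
          by (intro integral_mono Suc integrable_profile[OF profile_S]
              integrable_mult_right[OF integrable_profile[OF profile_L]])
        then show ?thesis using True by (simp add: line_def avg_def)
      qed (simp add: line_def)
      then have "(real b - c) * line (S n) q \<le> (real b - c) * ((real b - c) ^ n * line (L n) q)"
        by (rule mult_left_mono[OF _ bc])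
      with step[of n q] show ?case by simp
    qed simp
    have "x \<le> ((real b - c) * rate) ^ n" for n
    proof -
      have "x \<le> (real b - c) ^ n * L n 1" using ge[of n] S_le[of n 1] by linarith
      also have "\<dots> \<le> (real b - c) ^ n * rate ^ n" by (intro mult_left_mono L_le_rate) (use bc in auto)
      finally show ?thesis by (simp add: power_mult_distrib)
    qed
    moreover have "(\<lambda>n. ((real b - c) * rate) ^ n) \<longlonglongrightarrow> 0"
    proof (rule LIMSEQ_realpow_zero)
      show "0 \<le> (real b - c) * rate" using bc rate_pos by simp
      have "(real b - c) * rate \<le> (real b - c) * (1 / real b)" by (intro mult_left_mono assms bc)
      also have "\<dots> < 1" using c b_gt_1 by (simp add: field_simps)
      finally show "(real b - c) * rate < 1" .
    qed
    ultimately have "x \<le> 0" by (intro LIMSEQ_le_const) auto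
    with x show False by simp
  qed
  then obtain N where N: "S N 1 < x" by blast
  show "\<forall>\<^sub>F n in sequentially. S n 1 < x"
    using eventually_ge_at_top[of N]
  proof eventually_elim
    case (elim n)
    then show ?case using S_antimono[of N "n - N" 1] N by simp
  qed
qed

text \<open>An avalanche from load \<open>1\<close> raises its load above \<open>\<theta>\<close> within \<open>m\<close> generations with positive
  probability, so large avalanches from \<open>\<theta>\<close> would yield large ones from \<open>1\<close>.\<close>

lemma S_tendsto_0_below:
  assumes "rate \<le> 1 / real b" "\<theta> < q_star"
  shows "(\<lambda>n. S n \<theta>) \<longlonglongrightarrow> 0"
proof -
  obtain m p where p: "0 < p" "\<And>g. profile g \<Longrightarrow> p * g \<theta> \<le> (line ^^ m) g 1"
    using reach[OF assms(2)] by blast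
  have le: "S n \<theta> \<le> S (n + m) 1 / p" for n
  proof -
    have "p * S n \<theta> \<le> (branch ^^ m) (S n) 1"
      using p(2)[OF profile_S[of n]] line_pow_le_branch_pow[OF profile_S, of m n 1] by linarith
    also have "\<dots> = S (n + m) 1" by (simp add: add.commute funpow_add)
    finally show ?thesis using p by (simp add: field_simps)
  qed
  have "(\<lambda>n. S (n + m) 1 / p) \<longlonglongrightarrow> 0"
    using tendsto_divide[OF LIMSEQ_ignore_initial_segment[OF S_tendsto_0_at_1[OF assms(1)], of m] tendsto_const[of p]] p
    by simp
  then show ?thesis
    by (rule tendsto_sandwich[OF _ _ tendsto_const, rotated 2])
       (auto simp: profileD(2)[OF profile_S] le)
qed

lemma S_Suc_le_line: "S (Suc n) q \<le> real b * line (S n) q"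
proof -
  have "(real b - avg (S n) q) * line (S n) q \<le> real b * line (S n) q"
    using avg_nonneg[OF profile_S] profileD(2)[OF profile_line[OF profile_S]]
    by (intro mult_right_mono) auto
  then show ?thesis using branch_upper[OF profile_S, of n q] by simp
qed

lemma S_tendsto_0:
  assumes "rate \<le> 1 / real b"
  shows "(\<lambda>n. S n \<theta>) \<longlonglongrightarrow> 0"
proof (cases "\<theta> < q_star")
  case True
  then show ?thesis by (rule S_tendsto_0_below[OF assms])
next
  case False
  have b0: "0 < real b" using b_gt_1 by simp
  \<comment> \<open>the factor \<open>1 / (2 b)\<close> leaves a contraction by \<open>1 / 2\<close> after the union bound over \<open>b\<close> children\<close>
  obtain \<epsilon> where \<epsilon>: "0 < \<epsilon>"
    "\<And>g D. profile g \<Longrightarrow> 0 \<le> D \<Longrightarrow> D \<le> real b * \<epsilon> \<Longrightarrow>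
       line g (q_star + D) \<le> g (q_star - \<epsilon>) + 1 / (2 * real b) * g (q_star + D)"
    using decomposition_bound[of "1 / (2 * real b)"] b0 by auto
  have "(\<lambda>n. S n (q_star + (\<theta> - q_star))) \<longlonglongrightarrow> 0"
  proof (rule induct_above_q_star[OF \<epsilon>(1), where P="\<lambda>D. (\<lambda>n. S n (q_star + D)) \<longlonglongrightarrow> 0"])
    fix D assume D: "0 \<le> D" "D \<le> real b * \<epsilon>"
    show "(\<lambda>n. S n (q_star + D)) \<longlonglongrightarrow> 0"
    proof (rule contraction_tendsto_0)
      fix n
      have "S (Suc n) (q_star + D) \<le> real b * (S n (q_star - \<epsilon>) + 1 / (2 * real b) * S n (q_star + D))"
        using order_trans[OF S_Suc_le_line mult_left_mono[OF \<epsilon>(2)[OF profile_S D]]] b0 by simp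
      also have "\<dots> = real b * S n (q_star - \<epsilon>) + S n (q_star + D) / 2" using b0 by (simp add: field_simps)
      finally show "S (Suc n) (q_star + D) \<le> real b * S n (q_star - \<epsilon>) + S n (q_star + D) / 2" .
      show "S (Suc n) (q_star + D) \<le> S n (q_star + D)" using S_antimono[of n 1] by simp
      show "(\<lambda>n. real b * S n (q_star - \<epsilon>)) \<longlonglongrightarrow> 0"
        using tendsto_mult_right_zero[OF S_tendsto_0_below[OF assms, of "q_star - \<epsilon>"]] \<epsilon>(1) by simp
    qed (rule profileD(2)[OF profile_S])
  next
    fix D assume lim: "(\<lambda>n. S n (q_star + D / real b)) \<longlonglongrightarrow> 0"
    have "(\<lambda>n. real b * (S n (q_star - 1) + S n (q_star + D / real b))) \<longlonglongrightarrow> real b * (0 + 0)"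
      by (intro tendsto_intros lim S_tendsto_0_below[OF assms]) simp
    then have lim': "(\<lambda>n. real b * (S n (q_star - 1) + S n (q_star + D / real b))) \<longlonglongrightarrow> 0" by simp
    have "S (Suc n) (q_star + D) \<le> real b * (S n (q_star - 1) + S n (q_star + D / real b))" for n
      using order_trans[OF S_Suc_le_line mult_left_mono[OF line_le_below[OF profile_S]]] b0 by simp
    then have "(\<lambda>n. S (Suc n) (q_star + D)) \<longlonglongrightarrow> 0"
      by (intro tendsto_sandwich[OF _ _ tendsto_const lim'])
         (auto simp: profileD(2)[OF profile_S] simp del: funpow.simps)
    then show "(\<lambda>n. S n (q_star + D)) \<longlonglongrightarrow> 0" by (rule LIMSEQ_imp_Suc)
  qed (use False in simp)
  then show ?thesis by simp
qed

section \<open>Survival\<close>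

text \<open>Each of the first \<open>m\<close> iterates of \<open>p * alive\<close> is at most \<open>p b\<^sup>m\<close>, so every step loses at most
  the factor \<open>1 - p b\<^sup>m\<^sup>+\<^sup>1\<close> of \<open>branch_lower\<close> against \<open>b\<close> times the linear step.\<close>

lemma branch_pow_lower:
  assumes p: "0 \<le> p" "p * real b ^ Suc m \<le> 1"
  shows "k \<le> m \<Longrightarrow> (1 - p * real b ^ Suc m) ^ k * (p * real b ^ k * L k q)
           \<le> (branch ^^ k) (\<lambda>q. p * alive q) q \<and> (branch ^^ k) (\<lambda>q. p * alive q) q \<le> p * real b ^ k"
proof (induction k arbitrary: q)
  case 0
  show ?case using p by (auto simp: alive_def)
next
  case (Suc k)
  have B: "1 \<le> real b" using b_gt_1 by simp
  have "p * 1 \<le> p * real b ^ Suc m" using p B by (intro mult_left_mono one_le_power) auto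
  then have p1: "p \<le> 1" using p by simp
  let ?f = "(branch ^^ k) (\<lambda>q. p * alive q)"
  let ?a = "1 - p * real b ^ Suc m"
  have a: "0 \<le> ?a" "?a \<le> 1" using p by auto
  have prof: "profile ?f" using p p1 by (intro profile_branch_pow profile_scale profile_alive)
  have up: "?f x \<le> p * real b ^ k" for x using Suc by simp
  have le: "p * real b ^ k * real b \<le> p * real b ^ Suc m"
    using p B Suc.prems power_increasing[of "Suc k" "Suc m" "real b"]
    by (auto intro!: mult_left_mono simp: mult.assoc mult.commute[of _ "real b"])
  have lin: "?a ^ k * (p * real b ^ k) * line (L k) q \<le> line ?f q"
  proof (cases "1 \<le> q")
    case True
    have "(\<integral>x. ?a ^ k * (p * real b ^ k) * L k (x + q / real b) \<partial>\<rho>) \<le> avg ?f q"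
      unfolding avg_def
    proof (intro integral_mono integrable_profile[OF prof]
        integrable_mult_right[OF integrable_profile[OF profile_L]])
      fix x show "?a ^ k * (p * real b ^ k) * L k (x + q / real b) \<le> ?f (x + q / real b)"
        using Suc.IH[of "x + q / real b"] Suc.prems by (simp add: mult.assoc)
    qed
    then show ?thesis using True by (simp add: line_def avg_def)
  qed (simp add: line_def)
  have "?a ^ Suc k * (p * real b ^ Suc k * L (Suc k) q)
      = ?a * (real b * (?a ^ k * (p * real b ^ k) * line (L k) q))" by simp
  also have "\<dots> \<le> ?a * (real b * line ?f q)" using a B lin by (intro mult_left_mono) auto
  also have "\<dots> \<le> (1 - real b * (p * real b ^ k)) * (real b * line ?f q)"
    using le B profileD(2)[OF profile_line[OF prof], of q]
    by (intro mult_right_mono) (auto simp: mult.commute)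
  also have "\<dots> \<le> branch ?f q"
    using le p by (intro branch_lower[OF prof up]) simp
  finally have 1: "?a ^ Suc k * (p * real b ^ Suc k * L (Suc k) q) \<le> branch ?f q" .
  have "avg ?f q \<le> (\<integral>x. p * real b ^ k \<partial>\<rho>)" unfolding avg_def
    using up by (intro integral_mono integrable_profile[OF prof]) auto
  then have av: "avg ?f q \<le> p * real b ^ k" by (simp add: prob_space[simplified])
  have "branch ?f q \<le> (real b - avg ?f q) * line ?f q" by (rule branch_upper[OF prof])
  also have "\<dots> \<le> real b * line ?f q"
    using avg_nonneg[OF prof] profileD(2)[OF profile_line[OF prof]] by (intro mult_right_mono) auto
  also have "\<dots> \<le> real b * (p * real b ^ k)"
    using av B p by (intro mult_left_mono) (auto simp: line_def)
  finally have 2: "branch ?f q \<le> p * real b ^ Suc k" by (simp add: mult_ac)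
  show ?case using 1 2 by simp
qed

text \<open>The number \<open>p\<close> is taken so small that the loss in \<open>branch_pow_lower\<close> is outweighed by
  \<open>b\<^sup>m L m 1 > 1\<close>. Then \<open>p * alive\<close> is a lower barrier for \<open>m\<close> steps of the branching recursion.\<close>

lemma survival_lower:
  assumes "1 / real b < rate"
  obtains p where "0 < p" "\<And>n q. p * alive q \<le> S n q"
proof -
  have B: "1 < real b" using b_gt_1 by simp
  obtain m where m: "0 < m" "(1 / real b) ^ m < L m 1"
    using rate_approx[OF assms] B by (auto simp: max_def)
  then have m': "1 < real b ^ m * L m 1" using B by (simp add: field_simps)
  have "((\<lambda>p. (1 - p * real b ^ Suc m) ^ m * (real b ^ m * L m 1)) \<longlongrightarrow>
      (1 - 0 * real b ^ Suc m) ^ m * (real b ^ m * L m 1)) (at_right 0)"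
    by (intro tendsto_intros)
  then have "((\<lambda>p. (1 - p * real b ^ Suc m) ^ m * (real b ^ m * L m 1)) \<longlongrightarrow> real b ^ m * L m 1) (at_right 0)"
    by simp
  from order_tendstoD(1)[OF this m']
  have e1: "\<forall>\<^sub>F p in at_right 0. 1 < (1 - p * real b ^ Suc m) ^ m * (real b ^ m * L m 1)" .
  have e2: "\<forall>\<^sub>F p in at_right (0::real). p < 1 / real b ^ Suc m"
    by (rule order_tendstoD(2)[OF tendsto_ident_at]) (use B in simp)
  have e3: "\<forall>\<^sub>F p in at_right (0::real). 0 < p" by (rule eventually_at_right_less)
  obtain p where p: "1 < (1 - p * real b ^ Suc m) ^ m * (real b ^ m * L m 1)"
    "p < 1 / real b ^ Suc m" "0 < p"
    using eventually_happens'[OF trivial_limit_at_right_real eventually_conj[OF e1 eventually_conj[OF e2 e3]]] by blast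
  have pb: "p * real b ^ Suc m \<le> 1" using p(2) B by (simp add: field_simps)
  have "p * 1 \<le> p * real b ^ Suc m" using p B by (intro mult_left_mono one_le_power) auto
  then have p1: "p \<le> 1" using pb by simp
  have prof: "profile (\<lambda>q. p * alive q)" using p p1 by (intro profile_scale profile_alive) auto
  have base: "p * alive q \<le> (branch ^^ m) (\<lambda>q. p * alive q) q" for q
  proof (cases "1 \<le> q")
    case True
    let ?a = "(1 - p * real b ^ Suc m) ^ m"
    have "p * 1 \<le> p * (?a * (real b ^ m * L m 1))" using p by (intro mult_left_mono) auto
    also have "\<dots> = ?a * (p * real b ^ m * L m 1)" by simp
    also have "\<dots> \<le> ?a * (p * real b ^ m * L m q)"
      using pb p profileD(1)[OF profile_L True] by (intro mult_left_mono) auto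
    also have "\<dots> \<le> (branch ^^ m) (\<lambda>q. p * alive q) q"
      using branch_pow_lower[of p m m q] p pb by simp
    finally show ?thesis using True by (simp add: alive_def)
  next
    case False
    then show ?thesis using profileD(2)[OF profile_branch_pow[OF prof]] by (simp add: alive_def)
  qed
  have km: "p * alive q \<le> S (m * k) q" for k q
  proof (induction k arbitrary: q)
    case 0
    show ?case using p p1 by (simp add: alive_def)
  next
    case (Suc k)
    have "p * alive q \<le> (branch ^^ m) (\<lambda>q. p * alive q) q" by (rule base)
    also have "\<dots> \<le> (branch ^^ m) (S (m * k)) q" by (intro branch_pow_mono prof profile_S Suc)
    also have "\<dots> = S (m * Suc k) q" by (simp add: funpow_add)
    finally show ?case .
  qed
  show ?thesis
  proof (rule that[OF p(3)])
    fix n q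
    have "n \<le> m * n" using m by simp
    then have "S (m * n) q \<le> S n q" using S_antimono[of n "m * n - n" q] by simp
    with km[of q n] show "p * alive q \<le> S n q" by linarith
  qed
qed

section \<open>Probabilities as iterates\<close>

lemma Z_eq_L: "Z b \<rho> n \<theta> = L n \<theta>"
proof (induction n arbitrary: \<theta>)
  case 0
  have "prob_space (PiM {1::nat..} (\<lambda>_. \<rho>))" by (intro prob_space_PiM prob_space_axioms)
  from prob_space.prob_space[OF this] show ?case by (simp add: Z_def alive_def)
next
  case (Suc n)
  let ?P = "\<lambda>I. PiM (I :: nat set) (\<lambda>_. \<rho>)"
  show ?case
  proof (cases "1 \<le> \<theta>")
    case False
    then have never: "(\<forall>k\<le>Suc n. 1 \<le> Q b \<theta> X k) \<longleftrightarrow> False" for X by (auto intro: exI[of _ 0])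
    have "Z b \<rho> (Suc n) \<theta> = 0" unfolding Z_def never by simp
    then show ?thesis using False by (simp add: line_def)
  next
    case True
    let ?E = "\<lambda>n \<theta>. {X \<in> space (?P {1..}). \<forall>k\<le>n. 1 \<le> Q b \<theta> X k}"
    have ins: "{1..} = insert 1 {2::nat..}" by auto
    have E: "?E n \<theta> \<in> sets (?P {1..})" for n \<theta> by (rule sets_Q_event) simp
    have "Z b \<rho> (Suc n) \<theta> = measure (?P {1..}) (?E (Suc n) \<theta>)" by (simp add: Z_def)
    also have "\<dots> = (\<integral>x. measure (?P {2..}) {X \<in> space (?P {2..}). X(1 := x) \<in> ?E (Suc n) \<theta>} \<partial>\<rho>)"
      by (rule measure_PiM_insert[of 1 "{2::nat..}", folded ins, OF _ E]) simp
    also have "\<dots> = (\<integral>x. Z b \<rho> n (x + \<theta> / real b) \<partial>\<rho>)"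
    proof (intro Bochner_Integration.integral_cong refl)
      fix x
      have "X(1 := x) \<in> ?E (Suc n) \<theta> \<longleftrightarrow> (\<lambda>j\<in>{1..}. X (Suc j)) \<in> ?E n (x + \<theta> / real b)"
        if X: "X \<in> space (?P {2..})" for X
      proof -
        have "X(1 := x) \<in> space (?P {1..})" "(\<lambda>j\<in>{1..}. X (Suc j)) \<in> space (?P {1..})"
          using X by (auto simp: space_PiM PiE_iff extensional_def)
        moreover have "Q b \<theta> (X(1 := x)) (Suc k) = Q b (x + \<theta> / real b) (\<lambda>j\<in>{1..}. X (Suc j)) k" for k
          unfolding Q_Suc by (auto intro!: Q_cong)
        moreover have "(\<forall>k\<le>Suc n. P k) \<longleftrightarrow> P 0 \<and> (\<forall>k\<le>n. P (Suc k))" for P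
          by (metis Suc_le_mono le0 not0_implies_Suc)
        ultimately show ?thesis using True by simp
      qed
      then have "{X \<in> space (?P {2..}). X(1 := x) \<in> ?E (Suc n) \<theta>}
          = {X \<in> space (?P {2..}). (\<lambda>j\<in>{1..}. X (Suc j)) \<in> ?E n (x + \<theta> / real b)}" by blast
      then show "measure (?P {2..}) {X \<in> space (?P {2..}). X(1 := x) \<in> ?E (Suc n) \<theta>} = Z b \<rho> n (x + \<theta> / real b)"
        using measure_PiM_reindex[of Suc "{1..}" "{2..}", OF _ _ E] by (simp add: Z_def)
    qed
    also have "\<dots> = L (Suc n) \<theta>" using True by (simp add: Suc line_def[of "L n"] avg_def)
    finally show ?thesis .
  qed
qed

lemma z_fun_eq_rate: "z_fun b \<rho> = rate"
  unfolding z_fun_def Z_eq_L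
proof (rule the_equality)
  fix z assume "\<forall>\<theta>\<ge>1. (\<lambda>n. root n (L n \<theta>)) \<longlonglongrightarrow> z"
  then have "(\<lambda>n. root n (L n 1)) \<longlonglongrightarrow> z" by simp
  then show "z = rate" using tendsto_rate[of 1] by (intro LIMSEQ_unique) auto
qed (simp add: tendsto_rate)

abbreviation "J \<equiv> joint_law b \<rho>"

lemma prob_space_J: "prob_space J"
  unfolding joint_law_def by (intro prob_space_PiM prob_space_axioms)

lemma measurable_site: "\<sigma> \<in> tree b \<Longrightarrow> (\<lambda>X. X \<sigma>) \<in> borel_measurable J"
  using measurable_cong_sets[OF refl sets_rho] measurable_component_singleton[of \<sigma> "tree b" "\<lambda>_. \<rho>"]
  unfolding joint_law_def by blast

lemma measurable_total:
  assumes [measurable]: "h \<in> borel_measurable J"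
  shows "\<sigma> \<in> tree b \<Longrightarrow> (\<lambda>X. total b (h X) X \<sigma>) \<in> borel_measurable J"
proof (induction \<sigma> rule: rev_induct)
  case (snoc i \<sigma>)
  then have [measurable]: "(\<lambda>X. total b (h X) X \<sigma>) \<in> borel_measurable J"
    "(\<lambda>X. X (\<sigma> @ [i])) \<in> borel_measurable J"
    by (auto intro: measurable_site)
  show ?case unfolding total_snoc by measurable
qed simp

lemma sets_toppled:
  assumes "h \<in> borel_measurable J" "\<sigma> \<in> tree b"
  shows "Measurable.pred J (\<lambda>X. toppled b (h X) X \<sigma>)"
  using assms(2)
proof (induction \<sigma> rule: rev_induct)
  case Nil
  have [measurable]: "h \<in> borel_measurable J" by fact
  show ?case by simp
next
  case (snoc i \<sigma>)
  have [measurable]: "(\<lambda>X. total b (h X) X (\<sigma> @ [i])) \<in> borel_measurable J"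
    by (rule measurable_total[OF assms(1) snoc.prems])
  have [measurable]: "Measurable.pred J (\<lambda>X. toppled b (h X) X \<sigma>)" using snoc by simp
  show ?case unfolding toppled_snoc by measurable
qed

lemma sets_grows:
  assumes "h \<in> borel_measurable J"
  shows "{X \<in> space J. grows b n (h X) X} \<in> sets J"
proof -
  have "Measurable.pred J (\<lambda>X. grows b n (h X) X)"
    unfolding grows_def
    by (intro pred_intros_countable_bounded countable_tree pred_intros_logic sets_toppled assms) simp
  then show ?thesis by (simp add: pred_def)
qed

text \<open>Growth depends on the root value through the load only, so the root can be integrated out.\<close>

lemma prob_grows_random_root:
  assumes "\<And>q. measure J {X \<in> space J. grows b n q X} = S n q"
  shows "measure J {X \<in> space J. grows b n (X [] + c) X} = (\<integral>x. S n (x + c) \<partial>\<rho>)"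
proof -
  let ?I = "tree b - {[]}"
  let ?N = "PiM ?I (\<lambda>_. \<rho>)"
  let ?A = "{X \<in> space J. grows b n (X [] + c) X}"
  have J: "J = PiM (insert [] ?I) (\<lambda>_. \<rho>)" unfolding joint_law_def by (intro PiM_cong) auto
  have site: "(\<lambda>X. X [] + c) \<in> borel_measurable J"
    using measurable_site[of "[]"] by auto
  have "measure J ?A = (\<integral>x. measure ?N {X \<in> space ?N. X([] := x) \<in> ?A} \<partial>\<rho>)"
    using measure_PiM_insert[of "[]" ?I ?A] sets_grows[OF site] unfolding J by auto
  also have "\<dots> = (\<integral>x. S n (x + c) \<partial>\<rho>)"
  proof (intro Bochner_Integration.integral_cong refl)
    fix x
    let ?B = "{Y \<in> space J. grows b n (x + c) Y}"
    let ?C = "{X \<in> space ?N. grows b n (x + c) X}"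
    have eq: "{X \<in> space ?N. X([] := x) \<in> ?A} = ?C"
    proof (intro Collect_cong conj_cong refl)
      fix X assume X: "X \<in> space ?N"
      then have "X([] := x) \<in> space J" by (auto simp: joint_law_def space_PiM PiE_iff extensional_def)
      moreover have "grows b n (x + c) (X([] := x)) = grows b n (x + c) X" by (rule grows_cong) simp
      ultimately show "X([] := x) \<in> ?A \<longleftrightarrow> grows b n (x + c) X" by simp
    qed
    have "(\<lambda>X. X([] := x)) \<in> measurable ?N J"
      unfolding J by (intro measurable_fun_upd[where J="?I"]) auto
    from measurable_sets[OF this sets_grows[OF site]]
    have "{X \<in> space ?N. X([] := x) \<in> ?A} \<in> sets ?N" by (simp add: vimage_def Int_def conj_commute)
    then have C: "?C \<in> sets ?N" unfolding eq .
    have "measure ?N ?C = measure J {X \<in> space J. (\<lambda>j\<in>?I. X j) \<in> ?C}"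
      using measure_PiM_reindex[of "\<lambda>j. j" ?I "tree b" ?C] C by (auto simp: joint_law_def)
    also have "{X \<in> space J. (\<lambda>j\<in>?I. X j) \<in> ?C} = ?B"
    proof (intro Collect_cong conj_cong refl)
      fix X assume "X \<in> space J"
      then have "(\<lambda>j\<in>?I. X j) \<in> space ?N" by (auto simp: joint_law_def space_PiM PiE_iff extensional_def)
      moreover have "grows b n (x + c) (\<lambda>j\<in>?I. X j) = grows b n (x + c) X" by (rule grows_cong) simp
      ultimately show "(\<lambda>j\<in>?I. X j) \<in> ?C \<longleftrightarrow> grows b n (x + c) X" by simp
    qed
    also have "measure J ?B = S n (x + c)" by (rule assms)
    finally show "measure ?N {X \<in> space ?N. X([] := x) \<in> ?A} = S n (x + c)" unfolding eq .
  qed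
  finally show ?thesis .
qed

text \<open>The avalanche fails to reach depth \<open>n + 1\<close> iff it fails to reach depth \<open>n\<close> in each of the \<open>b\<close>
  subtrees. These read disjoint sets of sites, so the failures are independent, and each subtree
  has the law of the whole tree.\<close>

lemma prob_grows: "measure J {X \<in> space J. grows b n q X} = S n q"
proof (induction n arbitrary: q)
  case 0
  show ?case using prob_space.prob_space[OF prob_space_J] by (simp add: grows_0 alive_def)
next
  case (Suc n)
  interpret N: prob_space J by (rule prob_space_J)
  show ?case
  proof (cases "1 \<le> q")
    case False
    then show ?thesis by (simp add: grows_Suc branch_def)
  next
    case True
    let ?Y = "\<lambda>i X. \<lambda>\<tau>\<in>tree b. X (i # \<tau>)"
    let ?G = "{X \<in> space J. grows b n (X [] + q / real b) X}"
    have site: "(\<lambda>X. X [] + c) \<in> borel_measurable J" for c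
      using measurable_site[of "[]"] by auto
    have G: "?G \<in> sets J" by (rule sets_grows[OF site])
    have PG: "measure J ?G = avg (S n) q"
      unfolding avg_def by (rule prob_grows_random_root[OF Suc])
    have Ym: "?Y i \<in> measurable J J" if "i \<in> {1..b}" for i
      unfolding joint_law_def using that
      by (intro measurable_restrict measurable_component_singleton) auto
    have Pi: "measure J (?Y i -` (space J - ?G) \<inter> space J) = 1 - avg (S n) q" if i: "i \<in> {1..b}" for i
    proof -
      have "measure J (?Y i -` (space J - ?G) \<inter> space J)
          = measure J {X \<in> space J. ?Y i X \<in> space J - ?G}" by (intro arg_cong[where f="measure J"]) auto
      also have "\<dots> = measure J (space J - ?G)"
        using measure_PiM_reindex[of "Cons i" "tree b" "tree b" "space J - ?G"] i G
        by (auto simp: joint_law_def)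
      also have "\<dots> = 1 - avg (S n) q" using N.prob_compl[OF G] PG by simp
      finally show ?thesis .
    qed
    have indep: "N.indep_vars (\<lambda>_. J) ?Y {1..b}"
    proof -
      have "N.indep_vars (\<lambda>_. \<rho>) (\<lambda>\<sigma> X. X \<sigma>) (tree b)"
        using indep_vars_PiM_components[of "tree b"] unfolding joint_law_def
        by (metis empty_iff tree_simps(1))
      then have "N.indep_vars (\<lambda>i. PiM (Cons i ` tree b) (\<lambda>_. \<rho>))
          (\<lambda>i X. restrict (\<lambda>\<sigma>. X \<sigma>) (Cons i ` tree b)) {1..b}"
        by (rule N.indep_vars_restrict) (auto simp: disjoint_family_on_def)
      then have "N.indep_vars (\<lambda>_. J)
          (\<lambda>i X. ?Y i (restrict (\<lambda>\<sigma>. X \<sigma>) (Cons i ` tree b))) {1..b}"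
        unfolding joint_law_def
        by (rule N.indep_vars_compose2[unfolded joint_law_def, where Y="\<lambda>i X. \<lambda>\<tau>\<in>tree b. X (i # \<tau>)"])
           (intro measurable_restrict measurable_component_singleton imageI)
      then show ?thesis
        by (rule N.indep_vars_cong[THEN iffD1, rotated -1]) (auto simp: fun_eq_iff)
    qed
    have "{X \<in> space J. grows b (Suc n) q X} = space J - (\<Inter>i\<in>{1..b}. ?Y i -` (space J - ?G) \<inter> space J)"
    proof -
      have "?Y i X \<in> ?G \<longleftrightarrow> grows b n (X [i] + q / real b) (\<lambda>\<sigma>. X (i # \<sigma>))"
        if "X \<in> space J" "i \<in> {1..b}" for X i
      proof -
        have "?Y i X \<in> space J" using measurable_space[OF Ym[OF that(2)] that(1)] .
        moreover have "grows b n c (?Y i X) = grows b n c (\<lambda>\<sigma>. X (i # \<sigma>))" for c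
          by (rule grows_cong) simp
        ultimately show ?thesis by simp
      qed
      moreover have "?Y i X \<in> space J" if "X \<in> space J" "i \<in> {1..b}" for X i
        using measurable_space[OF Ym[OF that(2)] that(1)] .
      ultimately show ?thesis using True b_gt_1 unfolding grows_Suc by fastforce
    qed
    then have "measure J {X \<in> space J. grows b (Suc n) q X}
        = measure J (space J - (\<Inter>i\<in>{1..b}. ?Y i -` (space J - ?G) \<inter> space J))" by (rule arg_cong)
    also have "\<dots> = 1 - measure J (\<Inter>i\<in>{1..b}. ?Y i -` (space J - ?G) \<inter> space J)"
      using b_gt_1 G by (intro N.prob_compl sets.finite_INT measurable_sets[OF Ym]) auto
    also have "measure J (\<Inter>i\<in>{1..b}. ?Y i -` (space J - ?G) \<inter> space J)
        = (\<Prod>i\<in>{1..b}. measure J (?Y i -` (space J - ?G) \<inter> space J))"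
      using b_gt_1 G by (intro N.indep_varsD[OF indep]) auto
    also have "\<dots> = (1 - avg (S n) q) ^ b" using Pi by simp
    also have "1 - (1 - avg (S n) q) ^ b = S (Suc n) q"
      using True unfolding branch_S[symmetric] by (simp add: branch_def[of "S n"])
    finally show ?thesis .
  qed
qed

lemma AE_avalanche_infinite_iff:
  "AE X in J. infinite (avalanche b v X) \<longleftrightarrow> (\<forall>n. grows b n (X [] + v) X)"
proof -
  have "AE X in J. \<forall>\<sigma>\<in>tree b. 0 \<le> X \<sigma> \<and> X \<sigma> < 1"
    unfolding joint_law_def
  proof (subst AE_ball_countable[OF countable_tree], intro ballI AE_PiM_component prob_space_axioms)
    show "AE x in \<rho>. 0 \<le> x \<and> x < 1" using AE_unit AE_less_1 by eventually_elim auto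
  qed
  then show ?thesis
  proof eventually_elim
    case (elim X)
    have "avalanche b v X = {\<sigma> \<in> tree b. toppled b (X [] + v) X \<sigma>}"
      by (rule avalanche_eq_toppled) (use elim in auto)
    then show ?case using infinite_toppled_iff by simp
  qed
qed

text \<open>Continuity from above along the decreasing events that depth \<open>n\<close> is reached.\<close>

lemma prob_infinite_tendsto:
  "(\<lambda>n. \<integral>x. S n (x + v) \<partial>\<rho>) \<longlonglongrightarrow> measure J {X \<in> space J. infinite (avalanche b v X)}"
proof -
  interpret N: prob_space J by (rule prob_space_J)
  have site: "(\<lambda>X. X [] + v) \<in> borel_measurable J"
    using measurable_site[of "[]"] by auto
  let ?G = "\<lambda>n. {X \<in> space J. grows b n (X [] + v) X}"
  have G: "?G n \<in> sets J" for n by (rule sets_grows[OF site])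
  have "(\<lambda>n. measure J (?G n)) \<longlonglongrightarrow> measure J (\<Inter>n. ?G n)"
    using G by (intro N.finite_Lim_measure_decseq) (auto simp: decseq_def intro: grows_antimono)
  moreover have "measure J (\<Inter>n. ?G n) = measure J {X \<in> space J. infinite (avalanche b v X)}"
  proof (rule measure_eq_AE)
    show "AE X in J. X \<in> (\<Inter>n. ?G n) \<longleftrightarrow> X \<in> {X \<in> space J. infinite (avalanche b v X)}"
      using AE_avalanche_infinite_iff[of v] by eventually_elim auto
    show "{X \<in> space J. infinite (avalanche b v X)} \<in> sets J"
      by (rule sets_infinite_avalanche) simp
  qed (use G in auto)
  moreover have "measure J (?G n) = (\<integral>x. S n (x + v) \<partial>\<rho>)" for n
    by (rule prob_grows_random_root[OF prob_grows])
  ultimately show ?thesis by simp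
qed

lemma extinction:
  assumes "rate \<le> 1 / real b"
  shows "measure J {X \<in> space J. infinite (avalanche b v X)} = 0"
proof -
  have "(\<lambda>n. \<integral>x. S n (x + v) \<partial>\<rho>) \<longlonglongrightarrow> 0"
  proof (rule tendsto_sandwich[OF _ _ tendsto_const S_tendsto_0[OF assms, of "1 + v"]])
    have "(\<integral>x. S n (x + v) \<partial>\<rho>) \<le> (\<integral>x. S n (1 + v) \<partial>\<rho>)" for n
    proof (rule integral_mono_AE[OF integrable_profile[OF profile_S]])
      show "AE x in \<rho>. S n (x + v) \<le> S n (1 + v)"
        using AE_unit by eventually_elim (auto intro: profileD(1)[OF profile_S])
    qed simp
    then show "\<forall>\<^sub>F n in sequentially. (\<integral>x. S n (x + v) \<partial>\<rho>) \<le> S n (1 + v)"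
      by (simp add: prob_space[simplified])
    show "\<forall>\<^sub>F n in sequentially. 0 \<le> (\<integral>x. S n (x + v) \<partial>\<rho>)"
      by (intro always_eventually allI integral_nonneg_AE AE_I2 profileD(2)[OF profile_S])
  qed
  with prob_infinite_tendsto[of v] show ?thesis by (rule LIMSEQ_unique)
qed

lemma survival:
  assumes "1 / real b < rate" "1 - xstar < v"
  shows "0 < measure J {X \<in> space J. infinite (avalanche b v X)}"
proof -
  obtain p where p: "0 < p" "\<And>n q. p * alive q \<le> S n q" using survival_lower[OF assms(1)] by blast
  have pos: "0 < p * measure \<rho> {1 - v..}" using p below_x_star[of "1 - v"] assms(2) by simp
  have "p * measure \<rho> {1 - v..} \<le> (\<integral>x. S n (x + v) \<partial>\<rho>)" for n
  proof -
    have "p * measure \<rho> {1 - v..} = (\<integral>x. p * indicator {1 - v..} x \<partial>\<rho>)" by simp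
    also have "\<dots> \<le> (\<integral>x. S n (x + v) \<partial>\<rho>)"
    proof (rule integral_mono[OF _ integrable_profile[OF profile_S]])
      show "integrable \<rho> (\<lambda>x. p * indicator {1 - v..} x)"
        by (intro integrable_mult_right) (auto simp: integrable_indicator_iff emeasure_eq_measure)
      show "p * indicator {1 - v..} x \<le> S n (x + v)" for x
        using p(2)[of "x + v" n] by (auto simp: alive_def indicator_def)
    qed
    finally show ?thesis .
  qed
  then have "p * measure \<rho> {1 - v..} \<le> measure J {X \<in> space J. infinite (avalanche b v X)}"
    by (intro LIMSEQ_le_const[OF prob_infinite_tendsto]) auto
  with pos show ?thesis by linarith
qed

end

theorem theorem3p1:
  fixes b :: nat and \<rho> :: "real measure"
  assumes "b > 1" and "\<rho> \<in> M_flat b"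
  shows "(z_fun b \<rho> \<le> 1 / real b \<longrightarrow>
            (\<forall>v\<in>{0<..}. \<P>(X in joint_law b \<rho>. infinite (avalanche b v X)) = 0)) \<and>
         (z_fun b \<rho> > 1 / real b \<longrightarrow>
            (\<forall>v\<in>{1 - x_star \<rho><..}. \<P>(X in joint_law b \<rho>. infinite (avalanche b v X)) > 0))"
proof -
  interpret avalanche_model b \<rho> by unfold_locales (fact assms)+
  show ?thesis using extinction survival by (auto simp: z_fun_eq_rate)
qed

end
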